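(* Suppose $\mathcal{H}^{-1}>0$ (elementwise). Then there exists a $t_0>0$ such that the semidiscrete solution matrix satisfies $\mathcal{E}(t)>0$ (elementwise) for all $t>t_0$.
   Context: Fractional operator. $P(\partial_t)u(t)=\int_0^1\partial_t^\alpha u(t)\,d\nu(\alpha)$, where $\partial_t^\alpha$ is the Caputo derivative $\partial_t^\alpha u(t)=\frac{1}{\Gamma(1-\alpha)}\int_0^t(t-s)^{-\alpha}u'(s)\,ds$. One of two cases is assumed, with characteristic function $P(z)=\int_0^1z^\alpha d\nu(\alpha)$. Case I: $P(z)=\sum_{i=1}^m b_iz^{\alpha_i}$, $m\ge1$, $0<\alpha_m<\dots<\alpha_1<1$, $b_i>0$, $b_1=1$. Case II: $P(z)=\int_0^1z^\alpha\mu(\alpha)\,d\alpha$, with $\mu\ge0$ Hölder continuous on $[0,1]$ and $\mu(0)\mu(1)>0$. Finite elements. $\Omega\subset\mathbb{R}^2$ is a bounded polygonal domain, $\mathcal{T}_h$ a (conforming) triangulation of $\Omega$, $X_h\subset H_0^1(\Omega)$ the space of continuous functions that are linear on each triangle of $\mathcal{T}_h$ and vanish on $\partial\Omega$. $P_1,\dots,P_N$ are the interior nodes and $\phi_1,\dots,\phi_N$ the corresponding nodal basis. The stiffness matrix is $\mathcal{S}=(s_{ij})$, $s_{ij}=\int_\Omega\nabla\phi_j\cdot\nabla\phi_i\,dx$; the mass matrix is $\mathcal{M}=(m_{ij})$, $m_{ij}=[\phi_j,\phi_i]$, where $[\cdot,\cdot]$ is an inner product on $X_h$ (approximating the $L^2$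 inner product). Both matrices are symmetric positive definite, and $\mathcal{H}=\mathcal{M}^{-1}\mathcal{S}$. Semidiscrete solution matrix. $\mathcal{E}(t)$ is the matrix such that $U(t)=\mathcal{E}(t)V$ solves $P(\partial_t)U(t)+\mathcal{H}U(t)=0$ for $t>0$, $U(0)=V$. Equivalently, $\mathcal{E}$ is the continuous matrix function on $[0,\infty)$ with Laplace transform $z^{-1}P(z)(P(z)\mathcal{I}+\mathcal{H})^{-1}$, where $\mathcal{I}$ is the identity matrix. Matrix inequalities are meant elementwise. *)

theory Defs
  imports "HOL-Analysis.Analysis"
begin

section \<open>The fractional operator\<close>

definition caputo :: "real \<Rightarrow> (real \<Rightarrow> 'a::euclidean_space) \<Rightarrow> real \<Rightarrow> 'a" where
  "caputo \<alpha> u t =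
     (1 / Gamma (1 - \<alpha>)) *\<^sub>R
     (LINT s:{0..t}|lborel. (t - s) powr (- \<alpha>) *\<^sub>R vector_derivative u (at s))"

definition fractional_op :: "real measure \<Rightarrow> (real \<Rightarrow> 'a::euclidean_space) \<Rightarrow> real \<Rightarrow> 'a" where
  "fractional_op \<nu> u t = (LINT \<alpha>:{0..1}|\<nu>. caputo \<alpha> u t)"

definition characteristic_fun :: "real measure \<Rightarrow> complex \<Rightarrow> complex" where
  "characteristic_fun \<nu> z = (LINT \<alpha>:{0..1}|\<nu>. z powr complex_of_real \<alpha>)"

text \<open>Case I: the measure is a sum of point masses \<open>b i\<close> at the exponents \<open>\<alpha> i\<close>,
  written as the image under \<open>\<alpha>\<close> of the weights \<open>b\<close> on the index set.\<close>

definition multi_term_measure :: "nat \<Rightarrow> (nat \<Rightarrow> real) \<Rightarrow> (nat \<Rightarrow> real) \<Rightarrow> real measure" where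
  "multi_term_measure m b \<alpha> = distr (point_measure {1..m} (\<lambda>i. ennreal (b i))) borel \<alpha>"

definition multi_term :: "real measure \<Rightarrow> bool" where
  "multi_term \<nu> \<longleftrightarrow>
     (\<exists>m b \<alpha>. 1 \<le> m \<and> 0 < \<alpha> m \<and> strict_antimono_on {1..m} \<alpha> \<and> \<alpha> 1 < 1 \<and>
        (\<forall>i\<in>{1..m}. 0 < b i) \<and> b 1 = 1 \<and> \<nu> = multi_term_measure m b \<alpha>)"

definition hoelder_continuous_on :: "real set \<Rightarrow> (real \<Rightarrow> real) \<Rightarrow> bool" where
  "hoelder_continuous_on A f \<longleftrightarrow>
     (\<exists>\<gamma> C. 0 < \<gamma> \<and> \<gamma> \<le> 1 \<and> (\<forall>x\<in>A. \<forall>y\<in>A. \<bar>f x - f y\<bar> \<le> C * \<bar>x - y\<bar> powr \<gamma>))"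

definition distributed_order_measure :: "(real \<Rightarrow> real) \<Rightarrow> real measure" where
  "distributed_order_measure \<mu> = density lborel (\<lambda>\<alpha>. ennreal (indicator {0..1} \<alpha> * \<mu> \<alpha>))"

definition distributed_order :: "real measure \<Rightarrow> bool" where
  "distributed_order \<nu> \<longleftrightarrow>
     (\<exists>\<mu>. (\<forall>\<alpha>\<in>{0..1}. 0 \<le> \<mu> \<alpha>) \<and> hoelder_continuous_on {0..1} \<mu> \<and> 0 < \<mu> 0 * \<mu> 1 \<and>
        \<nu> = distributed_order_measure \<mu>)"

lemma characteristic_fun_multi_term:
  assumes "\<And>i. i \<in> {1..m} \<Longrightarrow> 0 \<le> b i" "\<And>i. i \<in> {1..m} \<Longrightarrow> \<alpha> i \<in> {0..1}"
  shows "characteristic_fun (multi_term_measure m b \<alpha>) z =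
           (\<Sum>i=1..m. complex_of_real (b i) * z powr complex_of_real (\<alpha> i))"
proof -
  have meas: "\<alpha> \<in> measurable (point_measure {1..m} (\<lambda>i. ennreal (b i))) borel"
    by (simp add: point_measure_def)
  have eq: "(\<lambda>a. indicator {0..1::real} a *\<^sub>R z powr complex_of_real a) =
      (\<lambda>a. if z = 0 then 0 else indicator {0..1} a *\<^sub>R exp (complex_of_real a * Ln z))"
    by (auto simp: powr_def)
  have "(\<lambda>a. indicator {0..1::real} a *\<^sub>R z powr complex_of_real a) \<in> borel_measurable borel"
    unfolding eq by measurable
  from integral_distr[OF meas this] show ?thesis
    using assms
    by (simp add: characteristic_fun_def multi_term_measure_def set_lebesgue_integral_def
        lebesgue_integral_point_measure_finite point_measure_def
        lebesgue_integral_count_space_finite AE_count_space integral_density scaleR_conv_of_real)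
qed

lemma characteristic_fun_distributed_order:
  assumes "\<And>a. a \<in> {0..1} \<Longrightarrow> 0 \<le> \<mu> a" "continuous_on {0..1} \<mu>"
  shows "characteristic_fun (distributed_order_measure \<mu>) z =
           (LINT \<alpha>:{0..1}|lborel. complex_of_real (\<mu> \<alpha>) * z powr complex_of_real \<alpha>)"
proof -
  have eq: "(\<lambda>a. indicator {0..1::real} a *\<^sub>R z powr complex_of_real a) =
      (\<lambda>a. if z = 0 then 0 else indicator {0..1} a *\<^sub>R exp (complex_of_real a * Ln z))"
    by (auto simp: powr_def)
  have m1: "(\<lambda>a. indicator {0..1::real} a *\<^sub>R z powr complex_of_real a) \<in> borel_measurable lborel"
    unfolding eq by measurable
  have m2: "(\<lambda>a. indicator {0..1::real} a * \<mu> a) \<in> borel_measurable lborel"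
    using borel_measurable_continuous_on_indicator[OF _ assms(2)] by simp
  have "AE a in lborel. 0 \<le> indicator {0..1::real} a * \<mu> a"
    using assms(1) by (auto simp: indicator_def)
  from integral_density[OF m1 m2 this] show ?thesis
    unfolding characteristic_fun_def distributed_order_measure_def set_lebesgue_integral_def
    by (auto intro!: Bochner_Integration.integral_cong
        simp: indicator_def scaleR_conv_of_real)
qed

text \<open>Classical solutions of \<open>P(\<partial>\<^sub>t) U + H U = 0\<close>, \<open>U(0) = V\<close>.  The derivative may be unbounded
  at the initial time, but has to be integrable there, as the Caputo derivative needs it.\<close>

definition is_solution ::
    "real measure \<Rightarrow> real^'n^'n \<Rightarrow> real^'n \<Rightarrow> (real \<Rightarrow> real^'n) \<Rightarrow> bool" where
  "is_solution \<nu> H V U \<longleftrightarrow>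
     continuous_on {0..} U \<and> U C1_differentiable_on {0<..} \<and>
     (\<forall>t>0. set_integrable lborel {0..t} (\<lambda>s. vector_derivative U (at s))) \<and>
     (\<forall>t>0. fractional_op \<nu> U t + H *v U t = 0) \<and> U 0 = V"

definition is_solution_matrix ::
    "real measure \<Rightarrow> real^'n^'n \<Rightarrow> (real \<Rightarrow> real^'n^'n) \<Rightarrow> bool" where
  "is_solution_matrix \<nu> H E \<longleftrightarrow> (\<forall>V. is_solution \<nu> H V (\<lambda>t. E t *v V))"


section \<open>The finite element discretization\<close>

definition polygonal_domain :: "(real^2) set \<Rightarrow> bool" where
  "polygonal_domain \<Omega> \<longleftrightarrow>
     \<Omega> \<noteq> {} \<and> open \<Omega> \<and> connected \<Omega> \<and> bounded \<Omega> \<and>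
     (\<exists>\<S>. finite \<S> \<and> (\<forall>(a, b)\<in>\<S>. a \<noteq> b) \<and> frontier \<Omega> = (\<Union>(a, b)\<in>\<S>. closed_segment a b))"

text \<open>The library notion \<^const>\<open>triangulation\<close> already demands that two members meet in a common
  face (conformity).  The last conjunct, that the boundary consists of edges, is automatic unless
  the domain has slits, i.e. lies on both sides of part of its boundary.\<close>

definition triangulates :: "(real^2) set set \<Rightarrow> (real^2) set \<Rightarrow> bool" where
  "triangulates \<T> \<Omega> \<longleftrightarrow>
     triangulation \<T> \<and> (\<forall>T\<in>\<T>. 2 simplex T) \<and> \<Union>\<T> = closure \<Omega> \<and>
     (\<exists>\<E>. (\<forall>e\<in>\<E>. aff_dim e = 1 \<and> (\<exists>T\<in>\<T>. e face_of T)) \<and> frontier \<Omega> = \<Union>\<E>)"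

text \<open>Functions on the closed domain are represented by their extension by zero, so that equality
  of functions is equality on the domain.\<close>

definition fe_space :: "(real^2) set set \<Rightarrow> (real^2) set \<Rightarrow> (real^2 \<Rightarrow> real) set" where
  "fe_space \<T> \<Omega> =
     {v. continuous_on (closure \<Omega>) v \<and> (\<forall>T\<in>\<T>. \<exists>a b. \<forall>x\<in>T. v x = a \<bullet> x + b) \<and>
         (\<forall>x. x \<notin> \<Omega> \<longrightarrow> v x = 0)}"

definition interior_nodes :: "(real^2) set set \<Rightarrow> (real^2) set \<Rightarrow> (real^2) set" where
  "interior_nodes \<T> \<Omega> = {p \<in> \<Omega>. \<exists>T\<in>\<T>. p extreme_point_of T}"

definition nodal_basis ::
    "(real^2) set set \<Rightarrow> (real^2) set \<Rightarrow> ('n \<Rightarrow> real^2) \<Rightarrow> ('n \<Rightarrow> real^2 \<Rightarrow> real) \<Rightarrow> bool" where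
  "nodal_basis \<T> \<Omega> P \<phi> \<longleftrightarrow>
     (\<forall>i. \<phi> i \<in> fe_space \<T> \<Omega>) \<and> (\<forall>i j. \<phi> i (P j) = (if i = j then 1 else 0))"

definition inner_product_on :: "('a \<Rightarrow> real) set \<Rightarrow> (('a \<Rightarrow> real) \<Rightarrow> ('a \<Rightarrow> real) \<Rightarrow> real) \<Rightarrow> bool" where
  "inner_product_on X ip \<longleftrightarrow>
     (\<forall>u\<in>X. \<forall>v\<in>X. ip u v = ip v u) \<and>
     (\<forall>u\<in>X. \<forall>v\<in>X. \<forall>w\<in>X. \<forall>a b. ip (\<lambda>x. a * u x + b * v x) w = a * ip u w + b * ip v w) \<and>
     (\<forall>u\<in>X. u \<noteq> (\<lambda>x. 0) \<longrightarrow> 0 < ip u u)"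

text \<open>For finite element functions the gradient exists off the edges, a null set; elsewhere the
  value is irrelevant to the stiffness matrix.\<close>

definition gradient :: "('a::real_inner \<Rightarrow> real) \<Rightarrow> 'a \<Rightarrow> 'a" where
  "gradient f x = (THE D. GDERIV f x :> D)"

definition stiffness_matrix :: "(real^2) set \<Rightarrow> ('n \<Rightarrow> real^2 \<Rightarrow> real) \<Rightarrow> real^'n^'n" where
  "stiffness_matrix \<Omega> \<phi> =
     (\<chi> i j. LINT x:\<Omega>|lebesgue. gradient (\<phi> j) x \<bullet> gradient (\<phi> i) x)"

definition mass_matrix ::
    "((real^2 \<Rightarrow> real) \<Rightarrow> (real^2 \<Rightarrow> real) \<Rightarrow> real) \<Rightarrow> ('n \<Rightarrow> real^2 \<Rightarrow> real) \<Rightarrow> real^'n^'n" where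
  "mass_matrix ip \<phi> = (\<chi> i j. ip (\<phi> j) (\<phi> i))"

text \<open>The order \<open><\<close> on \<open>real^'n^'n\<close> is not the strict elementwise order.\<close>

definition elementwise_pos :: "real^'n^'m \<Rightarrow> bool" where
  "elementwise_pos A \<longleftrightarrow> (\<forall>i j. 0 < A $ i $ j)"

end

theory Submission
  imports Defs
begin

text \<open>The operator \<open>P(\<partial>\<^sub>t)\<close> is convolution of the derivative with the decreasing kernel
  \<open>k(r) = \<integral> r\<^sup>-\<^sup>\<alpha> / \<Gamma>(1 - \<alpha>) d\<nu>(\<alpha>)\<close>. As \<open>\<M>\<close> and \<open>\<S>\<close> are symmetric
  positive definite, the left eigenvectors of \<open>\<H>\<close> span, and pairing a solution with one of
  them, of eigenvalue \<open>\<lambda> > 0\<close>, gives a scalar function \<open>u\<close> with \<open>k * u' = - \<lambda> u\<close>.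
  It suffices that \<open>u(t) / k(t)\<close> tends to \<open>u(0) / \<lambda>\<close>, because then \<open>\<E>(t) / k(t)\<close> tends to
  \<open>\<H>\<^sup>-\<^sup>1 > 0\<close>.

  The scalar limit needs no Laplace transform. A maximum principle shows that \<open>u\<close> is nonnegative
  and decreasing if \<open>u(0) \<ge> 0\<close>, and that \<open>\<lambda> u(t) \<ge> k(t) (u(0) - u(t))\<close>. For an upper bound
  of the same order the equation is averaged over \<open>[\<sigma>, T]\<close> with \<open>\<sigma>\<close> a fixed fraction of \<open>T\<close>,
  which by monotonicity of \<open>u\<close> bounds \<open>u(T)\<close>; the bounds match since \<open>k(t / q) \<le> q k(t)\<close> for
  \<open>q \<ge> 1\<close> and the mean of \<open>k\<close> over \<open>[0, T]\<close> is \<open>O(k(T))\<close>.\<close>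

section \<open>Symmetric matrix pencils\<close>

lemma dot_symmetric_matrix:
  fixes A :: "real^'n^'n"
  assumes "transpose A = A"
  shows "x \<bullet> (A *v y) = y \<bullet> (A *v x)"
  by (metis assms dot_lmul_matrix inner_commute transpose_matrix_vector)

lemma posdef_matrix_invertible:
  fixes A :: "real^'n^'n"
  assumes "\<And>x. x \<noteq> 0 \<Longrightarrow> 0 < x \<bullet> (A *v x)"
  shows "invertible A"
proof -
  have "inj ((*v) A)"
    unfolding matrix_left_invertible_injective[symmetric] matrix_left_invertible_ker
    using assms by (metis inner_zero_right less_irrefl)
  then show ?thesis
    by (simp add: invertible_left_inverse matrix_left_invertible_injective)
qed

lemma matrix_inv_invertible:
  fixes A :: "real^'n^'n"
  assumes "invertible A"
  shows "A ** matrix_inv A = mat 1" "matrix_inv A ** A = mat 1"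
  using someI_ex[OF assms[unfolded invertible_def]] unfolding matrix_inv_def by auto

text \<open>A minimizer of the Rayleigh quotient on the \<open>M\<close>-orthogonal complement of all eigenvectors
  would be a further eigenvector.\<close>

lemma generalized_eigenvectors_span:
  fixes M S :: "real^'n^'n"
  assumes symM: "transpose M = M" and symS: "transpose S = S"
    and posM: "\<And>x. x \<noteq> 0 \<Longrightarrow> 0 < x \<bullet> (M *v x)"
    and posS: "\<And>x. x \<noteq> 0 \<Longrightarrow> 0 < x \<bullet> (S *v x)"
  shows "span {v. \<exists>l>0. S *v v = l *\<^sub>R (M *v v)} = UNIV"
proof (rule ccontr)
  let ?E = "{v. \<exists>l>0. S *v v = l *\<^sub>R (M *v v)}"
  let ?V = "span ?E"
  assume "?V \<noteq> UNIV"
  \<comment> \<open>The image of \<open>?V\<close> under \<open>M\<close> has at most the dimension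
    of \<open>?V\<close>, so some nonzero vector is orthogonal to it; by symmetry of
    \<open>M\<close> this vector lies in the \<open>M\<close>-orthogonal complement
    \<open>W\<close>.\<close>
  then have "dim ?V < DIM(real^'n)"
    using dim_subset_UNIV[of ?V] dim_eq_full[of ?V] by (simp add: span_span le_neq_implies_less)
  moreover have "dim ((*v) M ` ?V) \<le> dim ?V"
    by (rule dim_image_le) simp
  ultimately have "dim ((*v) M ` ?V) < DIM(real^'n)" by simp
  from orthogonal_to_subspace_exists[OF this] obtain x
    where x: "x \<noteq> 0" "\<And>y. y \<in> span ((*v) M ` ?V) \<Longrightarrow> orthogonal x y" by blast
  define W where "W = {x. \<forall>v\<in>?V. v \<bullet> (M *v x) = 0}"
  have "v \<bullet> (M *v x) = 0" if "v \<in> ?V" for v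
    using x(2)[of "M *v v"] that dot_symmetric_matrix[OF symM, of v x]
    by (simp add: span_base orthogonal_def)
  then have "x \<in> W" by (simp add: W_def)
  have sub: "subspace W"
    unfolding W_def by (auto simp: subspace_def matrix_vector_right_distrib inner_add_right
        matrix_vector_mult_scaleR)
  \<comment> \<open>The Rayleigh quotient is homogeneous of degree 0, so its infimum over the
    nonzero elements of \<open>W\<close> is attained on the compact unit sphere of
    \<open>W\<close>.\<close>
  define K where "K = W \<inter> sphere 0 1"
  have "compact K"
    unfolding K_def by (simp add: closed_Int_compact closed_subspace sub)
  moreover have "(1 / norm x) *\<^sub>R x \<in> K"
    unfolding K_def using \<open>x \<in> W\<close> x(1) sub by (simp add: subspace_scale)
  moreover have "continuous_on K (\<lambda>x. (x \<bullet> (S *v x)) / (x \<bullet> (M *v x)))"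
  proof (intro continuous_intros ballI)
    fix x assume "x \<in> K"
    then show "x \<bullet> (M *v x) \<noteq> 0"
      using posM[of x] by (force simp: K_def)
  qed
  ultimately obtain v where v: "v \<in> K"
      "\<And>y. y \<in> K \<Longrightarrow> (v \<bullet> (S *v v)) / (v \<bullet> (M *v v)) \<le> (y \<bullet> (S *v y)) / (y \<bullet> (M *v y))"
    using continuous_attains_inf[of K "\<lambda>x. (x \<bullet> (S *v x)) / (x \<bullet> (M *v x))"] by blast
  define l where "l = (v \<bullet> (S *v v)) / (v \<bullet> (M *v v))"
  \<comment> \<open>With \<open>l\<close> the minimal quotient, this quadratic form is nonnegative
    on \<open>W\<close> and zero at \<open>v\<close>. Its first variation at \<open>v\<close> in a
    direction of \<open>W\<close>, twice the pairing with the residual \<open>r\<close>, must then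
    vanish.\<close>
  define q where "q x = x \<bullet> (S *v x) - l * (x \<bullet> (M *v x))" for x
  have v0: "v \<noteq> 0" "v \<in> W" using v(1) by (auto simp: K_def)
  have l: "l > 0"
    unfolding l_def using posM[OF v0(1)] posS[OF v0(1)] by simp
  have qv: "q v = 0"
    unfolding q_def l_def using posM[OF v0(1)] by simp
  have q_nonneg: "0 \<le> q y" if "y \<in> W" for y
  proof (cases "y = 0")
    case False
    define z where "z = (1 / norm y) *\<^sub>R y"
    have zK: "z \<in> K"
      unfolding z_def K_def using that False sub by (simp add: subspace_scale)
    have "z \<noteq> 0" using zK by (auto simp: K_def)
    have "0 \<le> q z"
      using v(2)[OF zK] posM[OF \<open>z \<noteq> 0\<close>] unfolding q_def l_def[symmetric]
      by (simp add: field_simps)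
    moreover have "q y = (norm y)\<^sup>2 * q z"
      unfolding q_def z_def using False
      by (simp add: matrix_vector_mult_scaleR power2_eq_square field_simps)
    ultimately show ?thesis by simp
  qed (simp add: q_def)
  define r where "r = S *v v - l *\<^sub>R (M *v v)"
  have rW: "y \<bullet> r = 0" if y: "y \<in> W" for y
  proof -
    have expand: "q (v + t *\<^sub>R y) = 2 * t * (y \<bullet> r) + t\<^sup>2 * q y" for t
    proof -
      have "q (v + t *\<^sub>R y) = q v + 2 * t * (y \<bullet> r) + t\<^sup>2 * q y"
        unfolding q_def r_def
        using dot_symmetric_matrix[OF symM, of v y] dot_symmetric_matrix[OF symS, of v y]
        by (simp add: matrix_vector_right_distrib matrix_vector_mult_scaleR inner_add_left
            inner_add_right inner_diff_right power2_eq_square algebra_simps)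
      then show ?thesis using qv by simp
    qed
    have nn: "0 \<le> 2 * t * (y \<bullet> r) + t\<^sup>2 * q y" for t
      unfolding expand[symmetric] by (rule q_nonneg) (simp add: sub v0 y subspace_add subspace_scale)
    show ?thesis
    proof (rule ccontr)
      assume ne: "y \<bullet> r \<noteq> 0"
      \<comment> \<open>\<open>q y\<close> may be zero, so 1 is added before dividing;
        \<open>t\<close> is the minimizer of the parabola with leading coefficient
        \<open>Q\<close>.\<close>
      define Q where "Q = q y + 1"
      have Q: "Q > 0" "q y < Q" using q_nonneg[OF y] by (auto simp: Q_def)
      define t where "t = - (y \<bullet> r) / Q"
      have "2 * t * (y \<bullet> r) + t\<^sup>2 * q y < 2 * t * (y \<bullet> r) + t\<^sup>2 * Q"
        using Q ne by (simp add: t_def)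
      also have "\<dots> = - (y \<bullet> r)\<^sup>2 / Q"
        using Q(1) by (simp add: t_def power2_eq_square field_simps)
      also have "\<dots> < 0" using ne Q(1) by simp
      finally show False using nn[of t] by simp
    qed
  qed
  \<comment> \<open>For an eigenvector \<open>e\<close>, symmetry turns
    \<open>e \<bullet> (S *v v)\<close> into a multiple of \<open>e \<bullet> (M *v v)\<close>, and
    the latter is zero because \<open>v\<close> is in \<open>W\<close>.\<close>
  have rV: "y \<bullet> r = 0" if "y \<in> ?V" for y
    using that
  proof (induction rule: span_induct_alt)
    case (step c e y)
    then obtain \<mu> where \<mu>: "S *v e = \<mu> *\<^sub>R (M *v e)" by blast
    have "e \<bullet> (M *v v) = 0"
      using v0(2) step(1) by (auto simp: W_def intro: span_base)
    then have "e \<bullet> r = 0"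
      unfolding r_def inner_diff_right
      using \<mu> dot_symmetric_matrix[OF symS, of e v] dot_symmetric_matrix[OF symM, of e v] by simp
    then show ?case using step by (simp add: inner_add_left)
  qed simp
  obtain M' where M': "M ** M' = mat 1"
    using posdef_matrix_invertible[OF posM] unfolding invertible_def by blast
  \<comment> \<open>Orthogonality of \<open>r\<close> to \<open>?V\<close> puts \<open>z\<close>
    into \<open>W\<close>; orthogonality of \<open>r\<close> to \<open>W\<close> then gives
    \<open>z \<bullet> (M *v z) = 0\<close>, hence \<open>r = 0\<close>. So \<open>v\<close> is an
    eigenvector, and as an element of both \<open>?V\<close> and \<open>W\<close> it is
    \<open>M\<close>-orthogonal to itself.\<close>
  define z where "z = M' *v r"
  have z: "M *v z = r"
    unfolding z_def by (simp add: matrix_vector_mul_assoc M')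
  have "z \<in> W" unfolding W_def using rV z by auto
  then have "z \<bullet> (M *v z) = 0" using rW z by simp
  then have "r = 0" using posM[of z] z by fastforce
  then have "v \<in> ?V"
    unfolding r_def using l by (intro span_base) auto
  then have "v \<bullet> (M *v v) = 0"
    using v0(2) by (auto simp: W_def)
  then show False using posM[OF v0(1)] by simp
qed


section \<open>Definiteness of the stiffness and mass matrices\<close>

lemma gradient_eqI:
  assumes "GDERIV f x :> D"
  shows "gradient f x = D"
  unfolding gradient_def
proof (rule the_equality)
  fix D' assume "GDERIV f x :> D'"
  then have "(\<lambda>h. h \<bullet> D') = (\<lambda>h. h \<bullet> D)"
    using assms unfolding gderiv_def by (rule has_derivative_unique)
  then have "\<forall>h. h \<bullet> D' = h \<bullet> D" by meson
  then show "D' = D"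
    by (simp only: vector_eq_ldot)
qed (fact assms)

lemma gradient_affine_on_open:
  assumes "open U" "x \<in> U" "\<And>y. y \<in> U \<Longrightarrow> f y = a \<bullet> y + b"
  shows "gradient f x = a"
proof (rule gradient_eqI)
  have "GDERIV (\<lambda>y. a \<bullet> y + b) x :> a"
    unfolding gderiv_def by (auto intro!: derivative_eq_intros simp: inner_commute)
  then show "GDERIV f x :> a"
    unfolding gderiv_def
    by (rule has_derivative_transform_within_open[OF _ assms(1,2)]) (simp add: assms(3))
qed

text \<open>Full affine dimension turns the relative interior, nonempty for a nonempty convex set,
  into the interior.\<close>

lemma full_simplex:
  fixes T :: "'a::euclidean_space set"
  assumes "int DIM('a) simplex T"
  shows "convex T" "compact T" "interior T \<noteq> {}" "closure (interior T) = T"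
proof -
  show cv: "convex T" and cp: "compact T"
    using assms by (auto simp: simplex intro: compact_convex_hull finite_imp_compact)
  have "aff_dim T = DIM('a)" using assms by (rule aff_dim_simplex)
  moreover from this have "T \<noteq> {}" by auto
  ultimately show ne: "interior T \<noteq> {}"
    using rel_interior_interior[of T] rel_interior_eq_empty[OF cv] by (simp add: aff_dim_eq_full)
  show "closure (interior T) = T"
    using convex_closure_interior[OF cv ne] cp by (simp add: compact_imp_closed)
qed

section \<open>Linear combinations of nodal basis functions\<close>

lemma fe_space_affineE:
  assumes "v \<in> fe_space \<T> \<Omega>" "T \<in> \<T>"
  obtains a b where "\<forall>x\<in>T. v x = a \<bullet> x + b"
proof -
  have "\<exists>a b. \<forall>x\<in>T. v x = a \<bullet> x + b"
    using assms by (simp add: fe_space_def)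
  then show thesis using that by blast
qed

lemma fe_space_combination:
  assumes "\<And>i. i \<in> I \<Longrightarrow> \<phi> i \<in> fe_space \<T> \<Omega>" "finite I"
  shows "(\<lambda>x. \<Sum>i\<in>I. c i * \<phi> i x) \<in> fe_space \<T> \<Omega>"
  using assms(2,1)
proof (induction I rule: finite_induct)
  case (insert k I)
  let ?v = "\<lambda>x. \<Sum>i\<in>I. c i * \<phi> i x"
  have k: "\<phi> k \<in> fe_space \<T> \<Omega>" and v: "?v \<in> fe_space \<T> \<Omega>" using insert by auto
  have "\<exists>a b. \<forall>x\<in>T. c k * \<phi> k x + ?v x = a \<bullet> x + b" if "T \<in> \<T>" for T
  proof -
    obtain a b where "\<forall>x\<in>T. \<phi> k x = a \<bullet> x + b"
      by (rule fe_space_affineE[OF k \<open>T \<in> \<T>\<close>])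
    moreover obtain a' b' where "\<forall>x\<in>T. ?v x = a' \<bullet> x + b'"
      by (rule fe_space_affineE[OF v \<open>T \<in> \<T>\<close>])
    ultimately have "\<forall>x\<in>T. c k * \<phi> k x + ?v x = (c k *\<^sub>R a + a') \<bullet> x + (c k * b + b')"
      by (simp add: inner_add_left algebra_simps)
    then show ?thesis by blast
  qed
  then show ?case
    using k v insert.hyps by (auto simp: fe_space_def intro!: continuous_intros)
qed (auto simp: fe_space_def intro: exI[of _ 0])

lemma inner_product_on_combination:
  assumes "inner_product_on X ip" "u \<in> X" "v \<in> X" "w \<in> X"
  shows "ip (\<lambda>x. a * u x + b * v x) w = a * ip u w + b * ip v w"
  using assms by (simp add: inner_product_on_def)

lemma inner_product_on_sum:
  assumes ip: "inner_product_on (fe_space \<T> \<Omega>) ip"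
    and I: "finite I" "\<And>i. i \<in> I \<Longrightarrow> \<phi> i \<in> fe_space \<T> \<Omega>" and w: "w \<in> fe_space \<T> \<Omega>"
  shows "ip (\<lambda>x. \<Sum>i\<in>I. c i * \<phi> i x) w = (\<Sum>i\<in>I. c i * ip (\<phi> i) w)"
  using I
proof (induction I rule: finite_induct)
  case empty
  show ?case
    using inner_product_on_combination[OF ip w w w, of 0 0] by simp
next
  case (insert k I)
  have v: "(\<lambda>x. \<Sum>i\<in>I. c i * \<phi> i x) \<in> fe_space \<T> \<Omega>"
    using insert by (intro fe_space_combination) auto
  have "\<phi> k \<in> fe_space \<T> \<Omega>" using insert.prems by simp
  from inner_product_on_combination[OF ip this v w, of "c k" 1]
  show ?case using insert by simp
qed

text \<open>Recovering the coefficients from the nodal values gives linear independence of the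
  \<open>\<phi> i\<close>, which makes both matrices definite and not merely semidefinite.\<close>

lemma nodal_combination:
  fixes \<phi> :: "'n::finite \<Rightarrow> real^2 \<Rightarrow> real"
  assumes "nodal_basis \<T> \<Omega> P \<phi>"
  shows "(\<Sum>i\<in>UNIV. c i * \<phi> i (P j)) = c j"
proof -
  have "c i * \<phi> i (P j) = (if i = j then c i else 0)" for i
    using assms by (simp add: nodal_basis_def)
  then show ?thesis by simp
qed

lemma transpose_mass_matrix:
  assumes "inner_product_on (fe_space \<T> \<Omega>) ip" "nodal_basis \<T> \<Omega> P \<phi>"
  shows "transpose (mass_matrix ip \<phi>) = mass_matrix ip \<phi>"
  using assms unfolding inner_product_on_def nodal_basis_def mass_matrix_def transpose_def
  by (simp add: vec_eq_iff)

text \<open>The quadratic form at \<open>c\<close> is \<open>ip v v\<close> for the finite element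
  function \<open>v\<close> with nodal values \<open>c\<close>.\<close>

lemma mass_matrix_posdef:
  fixes \<phi> :: "'n::finite \<Rightarrow> real^2 \<Rightarrow> real"
  assumes ip: "inner_product_on (fe_space \<T> \<Omega>) ip" and nb: "nodal_basis \<T> \<Omega> P \<phi>" and "c \<noteq> 0"
  shows "0 < c \<bullet> (mass_matrix ip \<phi> *v c)"
proof -
  define v where "v = (\<lambda>x. \<Sum>i\<in>UNIV. c $ i * \<phi> i x)"
  have \<phi>: "\<phi> i \<in> fe_space \<T> \<Omega>" for i using nb by (simp add: nodal_basis_def)
  have v: "v \<in> fe_space \<T> \<Omega>" unfolding v_def by (rule fe_space_combination) (auto simp: \<phi>)
  have sym: "ip f g = ip g f" if "f \<in> fe_space \<T> \<Omega>" "g \<in> fe_space \<T> \<Omega>" for f g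
    using ip that by (simp add: inner_product_on_def)
  have sum: "ip v w = (\<Sum>i\<in>UNIV. c $ i * ip (\<phi> i) w)" if "w \<in> fe_space \<T> \<Omega>" for w
    unfolding v_def using inner_product_on_sum[OF ip _ _ that, of UNIV \<phi> "($) c"] \<phi> by simp
  have "v (P i) = c $ i" for i
    unfolding v_def by (rule nodal_combination[OF nb])
  then have "v \<noteq> (\<lambda>x. 0)"
    using \<open>c \<noteq> 0\<close> by (auto simp: vec_eq_iff)
  then have "0 < ip v v" using ip v by (simp add: inner_product_on_def)
  also have "ip v v = (\<Sum>i\<in>UNIV. c $ i * (\<Sum>j\<in>UNIV. c $ j * ip (\<phi> j) (\<phi> i)))"
    unfolding sum[OF v] using sum[OF \<phi>] sym[OF \<phi> v] by simp
  also have "\<dots> = c \<bullet> (mass_matrix ip \<phi> *v c)"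
    by (simp add: inner_vec_def matrix_vector_mult_def mass_matrix_def mult.commute)
  finally show ?thesis .
qed

lemma transpose_stiffness_matrix:
  "transpose (stiffness_matrix \<Omega> \<phi>) = stiffness_matrix \<Omega> \<phi>"
  by (simp add: transpose_def stiffness_matrix_def vec_eq_iff inner_commute)

text \<open>A combination whose gradient vanishes is constant on every triangle, so it takes finitely
  many values on the connected closure of the domain and is zero because it is zero on the
  boundary.\<close>

lemma stiffness_matrix_posdef:
  fixes \<phi> :: "'n::finite \<Rightarrow> real^2 \<Rightarrow> real"
  assumes dom: "polygonal_domain \<Omega>" and tri: "triangulates \<T> \<Omega>"
    and nb: "nodal_basis \<T> \<Omega> P \<phi>" and nodes: "range P \<subseteq> \<Omega>" and "c \<noteq> 0"
  shows "0 < c \<bullet> (stiffness_matrix \<Omega> \<phi> *v c)"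
proof -
  have \<Omega>: "\<Omega> \<noteq> {}" "open \<Omega>" "connected \<Omega>" "bounded \<Omega>"
    using dom by (auto simp: polygonal_domain_def)
  have \<T>: "finite \<T>" "\<Union>\<T> = closure \<Omega>" "\<And>T. T \<in> \<T> \<Longrightarrow> 2 simplex T"
    using tri by (auto simp: triangulates_def triangulation_def)
  have simp2: "int DIM(real^2) simplex T" if "T \<in> \<T>" for T using \<T>(3)[OF that] by simp
  note T_props = full_simplex[OF simp2]
  have \<phi>: "\<phi> i \<in> fe_space \<T> \<Omega>" for i using nb by (simp add: nodal_basis_def)
  define G where "G i = gradient (\<phi> i)" for i
  define U where "U = (\<Union>T\<in>\<T>. interior T)"
  have "\<exists>a. \<forall>x\<in>interior T. G i x = a" if "T \<in> \<T>" for T i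
  proof -
    obtain a b where "\<forall>x\<in>T. \<phi> i x = a \<bullet> x + b"
      by (rule fe_space_affineE[OF \<phi> \<open>T \<in> \<T>\<close>])
    then have "\<forall>x\<in>interior T. G i x = a"
      unfolding G_def using interior_subset[of T]
      by (intro ballI gradient_affine_on_open[OF open_interior]) auto
    then show ?thesis ..
  qed
  then obtain A where A: "\<And>T i x. T \<in> \<T> \<Longrightarrow> x \<in> interior T \<Longrightarrow> G i x = A T i" by metis
  have contG: "continuous_on U (G i)" for i
    unfolding U_def
  proof (rule continuous_on_open_UN)
    fix T assume "T \<in> \<T>"
    then show "continuous_on (interior T) (G i)"
      using A by (intro continuous_on_eq[OF continuous_on_const[of _ "A T i"]]) auto
  qed simp
  \<comment> \<open>The integrand of a stiffness entry is restricted to the open triangles, where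
    gradients exist and are constant. It is therefore Borel and bounded, and the removed part of the
    domain lies in the triangle boundaries, which are frontiers of convex sets and hence
    negligible.\<close>
  define h where "h i j x = indicator (\<Omega> \<inter> U) x *\<^sub>R (G j x \<bullet> G i x)" for i j x
  have openU: "open (\<Omega> \<inter> U)" unfolding U_def using \<Omega>(2) by auto
  have int_h: "integrable lebesgue (h i j)" for i j
  proof -
    have "finite ((\<lambda>T. A T j \<bullet> A T i) ` \<T>)" using \<T>(1) by simp
    from finite_imp_bounded[OF this, unfolded bounded_iff] obtain B
      where B: "\<And>T. T \<in> \<T> \<Longrightarrow> norm (A T j \<bullet> A T i) \<le> B" by auto
    have m: "h i j \<in> borel_measurable borel"
      unfolding h_def using openU
      by (intro borel_measurable_continuous_on_indicator continuous_intros
          continuous_on_subset[OF contG]) auto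
    have "integrable lebesgue (\<lambda>x. indicator (\<Omega> \<inter> U) x *\<^sub>R h i j x)"
    proof (rule integrableI_bounded_set_indicator[where B = B])
      have "bounded (\<Omega> \<inter> U)" using \<Omega>(4) by (rule bounded_subset) auto
      then show "emeasure lebesgue (\<Omega> \<inter> U) < \<infinity>"
        using emeasure_bounded_finite[of "\<Omega> \<inter> U"] openU by (simp add: less_top)
      show "AE x in lebesgue. x \<in> \<Omega> \<inter> U \<longrightarrow> norm (h i j x) \<le> B"
        using B A by (auto simp: h_def U_def)
    qed (use openU m in \<open>auto intro: measurable_completion\<close>)
    also have "(\<lambda>x. indicator (\<Omega> \<inter> U) x *\<^sub>R h i j x) = h i j"
      by (auto simp: h_def indicator_def)
    finally show ?thesis .
  qed
  have null: "AE x in lebesgue. x \<in> \<Omega> \<longrightarrow> x \<in> U"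
  proof -
    have "negligible (\<Union>T\<in>\<T>. frontier T)"
      using \<T>(1) T_props(1) by (intro negligible_Union) (auto intro: negligible_convex_frontier)
    moreover have "x \<in> (\<Union>T\<in>\<T>. frontier T)" if x: "x \<in> \<Omega>" "x \<notin> U" for x
    proof -
      have "x \<in> \<Union>\<T>" unfolding \<T>(2) using x(1) closure_subset by blast
      then obtain T where "T \<in> \<T>" "x \<in> T" by blast
      then show ?thesis
        using x(2) closure_subset[of T] by (auto simp: U_def frontier_def)
    qed
    ultimately show ?thesis
      by (intro AE_I'[where N = "\<Union>T\<in>\<T>. frontier T"]) (auto simp: negligible_iff_null_sets)
  qed
  have S: "stiffness_matrix \<Omega> \<phi> $ i $ j = integral\<^sup>L lebesgue (h i j)" for i j
  proof -
    let ?f = "\<lambda>x. indicator \<Omega> x *\<^sub>R (G j x \<bullet> G i x)"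
    have ae: "AE x in lebesgue. h i j x = ?f x"
      using null by eventually_elim (auto simp: h_def indicator_def)
    then have "?f \<in> borel_measurable lebesgue"
      using borel_measurable_AE[of "h i j" ?f] int_h by blast
    then have "integral\<^sup>L lebesgue (h i j) = integral\<^sup>L lebesgue ?f"
      using int_h ae by (intro integral_cong_AE) auto
    then show ?thesis
      by (simp add: stiffness_matrix_def set_lebesgue_integral_def G_def)
  qed
  \<comment> \<open>On the open triangles this is the squared norm of the gradient of the
    combination with coefficients \<open>c\<close>; its integral is the quadratic form.\<close>
  define g where "g x = indicator (\<Omega> \<inter> U) x * (norm (\<Sum>i\<in>UNIV. c $ i *\<^sub>R G i x))\<^sup>2" for x
  have g_sum: "g x = (\<Sum>i\<in>UNIV. \<Sum>j\<in>UNIV. c $ i * c $ j * h i j x)" for x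
    unfolding g_def h_def power2_norm_eq_inner inner_sum_left inner_sum_right
    by (simp add: sum_distrib_left inner_commute algebra_simps)
  have int_g: "integrable lebesgue g" unfolding g_sum using int_h by (intro Bochner_Integration.integrable_sum) auto
  have quad: "c \<bullet> (stiffness_matrix \<Omega> \<phi> *v c) = integral\<^sup>L lebesgue g"
    unfolding g_sum using int_h
    by (simp add: inner_vec_def matrix_vector_mult_def S Bochner_Integration.integral_sum sum_distrib_left algebra_simps)
  have "integral\<^sup>L lebesgue g \<noteq> 0"
  proof
    assume "integral\<^sup>L lebesgue g = 0"
    then have ae: "AE x in lebesgue. g x = 0"
      using integral_nonneg_eq_0_iff_AE[OF int_g] by (simp add: g_def)
    \<comment> \<open>A nonzero constant gradient on \<open>T\<close> would make \<open>g\<close>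
      nonzero on \<open>\<Omega> \<inter> interior T\<close>. This open set is nonempty since
      \<open>interior T\<close> lies in the closure of the domain, so it cannot be
      negligible.\<close>
    have zero: "(\<Sum>i\<in>UNIV. c $ i *\<^sub>R A T i) = 0" if T: "T \<in> \<T>" for T
    proof (rule ccontr)
      assume ne: "(\<Sum>i\<in>UNIV. c $ i *\<^sub>R A T i) \<noteq> 0"
      have "interior T \<subseteq> closure \<Omega>" using \<T>(2) T interior_subset by blast
      then have "\<Omega> \<inter> interior T \<noteq> {}"
        using T_props(3)[OF T] open_Int_closure_eq_empty[OF open_interior[of T], of \<Omega>]
        by (simp add: inf.absorb2 Int_commute[of "interior T"])
      then have "\<not> negligible (\<Omega> \<inter> interior T)"
        by (intro open_not_negligible open_Int \<Omega>(2) open_interior)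
      moreover have "\<Omega> \<inter> interior T \<subseteq> {x. g x \<noteq> 0}"
        using ne A[OF T] T by (auto simp: g_def U_def indicator_def)
      moreover have "negligible {x. g x \<noteq> 0}"
      proof -
        note [measurable] = borel_measurable_integrable[OF int_g]
        have "{x \<in> space lebesgue. g x \<noteq> 0} \<in> sets lebesgue" by measurable
        then show ?thesis
          using AE_iff_null_sets[of "{x. g x \<noteq> 0}" lebesgue] ae
          by (simp add: negligible_iff_null_sets)
      qed
      ultimately show False using negligible_subset[of "{x. g x \<noteq> 0}"] by simp
    qed
    define v where "v = (\<lambda>x. \<Sum>i\<in>UNIV. c $ i * \<phi> i x)"
    have v: "v \<in> fe_space \<T> \<Omega>" unfolding v_def by (rule fe_space_combination) (auto simp: \<phi>)
    have "\<exists>b. \<forall>x\<in>T. v x = b" if T: "T \<in> \<T>" for T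
    proof -
      have "\<exists>b. \<forall>x\<in>T. \<phi> i x = A T i \<bullet> x + b" for i
      proof -
        obtain a b where ab: "\<forall>x\<in>T. \<phi> i x = a \<bullet> x + b"
          by (rule fe_space_affineE[OF \<phi> T])
        obtain y where y: "y \<in> interior T" using T_props(3)[OF T] by blast
        have "G i y = a"
          unfolding G_def using ab interior_subset[of T]
          by (intro gradient_affine_on_open[OF open_interior y]) auto
        then show ?thesis using ab A[OF T y] by auto
      qed
      then obtain b where "\<And>i x. x \<in> T \<Longrightarrow> \<phi> i x = A T i \<bullet> x + b i" by metis
      then have "v x = (\<Sum>i\<in>UNIV. c $ i *\<^sub>R A T i) \<bullet> x + (\<Sum>i\<in>UNIV. c $ i * b i)" if "x \<in> T" for x
        unfolding v_def using that by (simp add: inner_sum_left sum.distrib algebra_simps)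
      then show ?thesis using zero[OF T] by auto
    qed
    then obtain b where b: "\<And>T x. T \<in> \<T> \<Longrightarrow> x \<in> T \<Longrightarrow> v x = b T" by metis
    have "v ` closure \<Omega> \<subseteq> b ` \<T>" unfolding \<T>(2)[symmetric] using b by auto
    then have "finite (v ` closure \<Omega>)" using \<T>(1) finite_subset by blast
    moreover have "connected (v ` closure \<Omega>)"
      using v \<Omega>(3) by (intro connected_continuous_image connected_imp_connected_closure) (auto simp: fe_space_def)
    ultimately have single: "v ` closure \<Omega> = {} \<or> (\<exists>y. v ` closure \<Omega> = {y})"
      by (simp add: connected_finite_iff_sing)
    \<comment> \<open>Only the empty set and the whole plane have empty frontier, and the domain is
      nonempty and bounded. Being open, it misses its frontier, where elements of
      \<open>fe_space\<close> are zero by definition.\<close>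
    have "frontier \<Omega> \<noteq> {}"
      using \<Omega> by (auto simp: frontier_eq_empty)
    then obtain y where y: "y \<in> closure \<Omega>" "y \<notin> \<Omega>"
      using \<Omega>(2) by (auto simp: frontier_def interior_open)
    then have "v y = 0" using v by (simp add: fe_space_def)
    moreover obtain z where "v ` closure \<Omega> = {z}"
      using single y(1) by (metis empty_iff image_is_empty)
    then have "v x = z" if "x \<in> closure \<Omega>" for x
      using that by (metis imageI singletonD)
    ultimately have "v x = 0" if "x \<in> closure \<Omega>" for x
      using that y(1) by simp
    moreover have "P j \<in> closure \<Omega>" for j
      using nodes closure_subset[of \<Omega>] by (auto simp: image_subset_iff)
    ultimately have "c $ j = 0" for j
      using nodal_combination[OF nb, of "($) c" j] by (simp add: v_def)
    then show False using \<open>c \<noteq> 0\<close> by (simp add: vec_eq_iff)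
  qed
  moreover have "integral\<^sup>L lebesgue g \<ge> 0"
    by (rule Bochner_Integration.integral_nonneg) (simp add: g_def)
  ultimately show ?thesis using quad by simp
qed


section \<open>Scalar relaxation equations\<close>

locale memory_kernel =
  fixes k :: "real \<Rightarrow> real"
  assumes measurable_kernel [measurable]: "k \<in> borel_measurable borel"
    and kernel_nonneg: "\<And>r. 0 \<le> k r"
    and kernel_decreasing: "\<And>r s. 0 < r \<Longrightarrow> r \<le> s \<Longrightarrow> k s \<le> k r"
    and integrable_kernel: "\<And>T. set_integrable lborel {0..T} k"
begin

text \<open>The kernel may blow up at \<open>s = t\<close> and \<open>f\<close> at
  \<open>s = 0\<close>. The point \<open>a\<close> separates the two: on \<open>[0, a]\<close> the
  kernel is at most \<open>k (t - a)\<close>, on \<open>[a, t]\<close> the function is bounded by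
  \<open>B\<close>.\<close>

lemma convolution_integrable:
  fixes f :: "real \<Rightarrow> 'a::euclidean_space"
  assumes a: "0 \<le> a" "a < t" and f: "set_integrable lborel {0..t} f"
    and B: "\<And>s. s \<in> {a..t} \<Longrightarrow> norm (f s) \<le> B"
  shows "set_integrable lborel {0..t} (\<lambda>s. k (t - s) *\<^sub>R f s)"
proof -
  have meas: "set_borel_measurable lborel {p..q} (\<lambda>s. k (t - s) *\<^sub>R f s)"
    if "0 \<le> p" "q \<le> t" for p q
  proof -
    have "set_integrable lborel {p..q} f"
      using f by (rule set_integrable_subset) (use that in auto)
    then have [measurable]: "(\<lambda>s. indicator {p..q} s *\<^sub>R f s) \<in> borel_measurable borel"
      unfolding set_integrable_def by (auto dest: borel_measurable_integrable)
    have "(\<lambda>s. k (t - s) *\<^sub>R (indicator {p..q} s *\<^sub>R f s)) \<in> borel_measurable borel"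
      by measurable
    then show ?thesis
      by (simp add: set_borel_measurable_def mult.commute)
  qed
  have "set_integrable lborel {0..a} (\<lambda>s. k (t - s) *\<^sub>R f s)"
  proof (rule set_integrable_bound)
    show "set_integrable lborel {0..a} (\<lambda>s. k (t - a) *\<^sub>R f s)"
      using set_integrable_subset[OF f, of "{0..a}"] a by simp
    have "k (t - s) \<le> k (t - a)" if "s \<in> {0..a}" for s
      using that a by (intro kernel_decreasing) auto
    then show "AE s in lborel. s \<in> {0..a} \<longrightarrow> norm (k (t - s) *\<^sub>R f s) \<le> norm (k (t - a) *\<^sub>R f s)"
      by (intro AE_I2) (simp add: kernel_nonneg mult_right_mono)
  qed (use a meas in auto)
  moreover have "set_integrable lborel {a..t} (\<lambda>s. k (t - s) *\<^sub>R f s)"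
  proof (rule set_integrable_bound)
    have "integrable lborel (\<lambda>s. indicator {0..t - a} (t + - 1 * s) *\<^sub>R k (t + - 1 * s))"
      using integrable_kernel[of "t - a"] unfolding set_integrable_def
      by (intro lborel_integrable_real_affine) auto
    also have "(\<lambda>s. indicator {0..t - a} (t + - 1 * s) *\<^sub>R k (t + - 1 * s))
        = (\<lambda>s. indicator {a..t} s *\<^sub>R k (t - s))"
      by (auto simp: indicator_def)
    finally have "set_integrable lborel {a..t} (\<lambda>s. k (t - s))"
      by (simp add: set_integrable_def)
    then show "set_integrable lborel {a..t} (\<lambda>s. B * k (t - s))" by simp
    have "norm (k (t - s) *\<^sub>R f s) \<le> norm (B * k (t - s))" if "s \<in> {a..t}" for s
    proof -
      have "norm (k (t - s) *\<^sub>R f s) = norm (f s) * k (t - s)"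
        by (simp add: kernel_nonneg)
      also have "\<dots> \<le> B * k (t - s)"
        using B[OF that] by (intro mult_right_mono kernel_nonneg) auto
      finally show ?thesis by simp
    qed
    then show "AE s in lborel. s \<in> {a..t} \<longrightarrow> norm (k (t - s) *\<^sub>R f s) \<le> norm (B * k (t - s))"
      by simp
  qed (use a meas in auto)
  ultimately have "set_integrable lborel ({0..a} \<union> {a..t}) (\<lambda>s. k (t - s) *\<^sub>R f s)"
    by (intro set_integrable_Un) auto
  also have "{0..a} \<union> {a..t} = {0..t}" using a by auto
  finally show ?thesis .
qed

text \<open>By monotonicity half of \<open>e * k e\<close> is at most the integral of
  \<open>k\<close> over \<open>[e/2, e]\<close>, hence at most the integral over
  \<open>[0, e]\<close>, which vanishes with \<open>e\<close>.\<close>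

lemma kernel_vanishing_moment: "((\<lambda>e. e * k e) \<longlongrightarrow> 0) (at_right 0)"
proof (rule tendsto_sandwich[OF _ _ tendsto_const])
  have k1: "k integrable_on {0..1}"
    using set_borel_integral_eq_integral(1)[OF integrable_kernel] .
  have "continuous_on {0..1} (\<lambda>x. 2 * integral {0..x} k)"
    by (intro continuous_intros indefinite_integral_continuous_1 k1)
  then have "((\<lambda>x. 2 * integral {0..x} k) \<longlongrightarrow> 2 * integral {0..0} k) (at 0 within {0..1})"
    unfolding continuous_on_def by (rule bspec) simp
  then show "((\<lambda>x. 2 * integral {0..x} k) \<longlongrightarrow> 0) (at_right 0)"
    by (simp add: at_within_Icc_at_right)
  show "\<forall>\<^sub>F e in at_right 0. 0 \<le> e * k e"
    by (auto simp: eventually_at_right_less kernel_nonneg intro!: eventually_at_rightI[of 0 1])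
  have "e * k e \<le> 2 * integral {0..e} k" if e: "0 < e" for e
  proof -
    have ke: "k integrable_on {0..e}"
      using set_borel_integral_eq_integral(1)[OF integrable_kernel] .
    have ke': "k integrable_on {e/2..e}"
      by (rule integrable_on_subinterval[OF ke]) (use e in auto)
    have "integral {e/2..e} (\<lambda>_. k e) \<le> integral {e/2..e} k"
      using ke' e by (intro integral_le) (auto intro: kernel_decreasing)
    also have "\<dots> \<le> integral {0..e} k"
      using ke ke' e kernel_nonneg by (intro integral_subset_le) auto
    finally show ?thesis using e by simp
  qed
  then show "\<forall>\<^sub>F e in at_right 0. e * k e \<le> 2 * integral {0..e} k"
    by (auto intro!: eventually_at_rightI[of 0 1])
qed

text \<open>The second mean value theorem on \<open>[0, t - e]\<close>, in the limit \<open>e \<rightarrow> 0\<close>; no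
  differentiability of the kernel is involved.\<close>

lemma maximum_principle:
  assumes a: "0 \<le> a" "a < t" and f: "set_integrable lborel {0..t} f"
    and B: "\<And>s. s \<in> {a..t} \<Longrightarrow> \<bar>f s\<bar> \<le> B"
    and w: "\<And>s. 0 \<le> s \<Longrightarrow> s \<le> t \<Longrightarrow> w s = w 0 + integral {0..s} f"
    and max: "\<And>s. 0 \<le> s \<Longrightarrow> s \<le> t \<Longrightarrow> w s \<le> w t"
  shows "k t * (w t - w 0) \<le> (LINT s:{0..t}|lborel. k (t - s) * f s)"
proof -
  define I where "I s = integral {0..s} (\<lambda>s. k (t - s) * f s)" for s
  have kf: "set_integrable lborel {0..t} (\<lambda>s. k (t - s) * f s)"
    using convolution_integrable[OF a f, of B] B by simp
  have kf': "(\<lambda>s. k (t - s) * f s) integrable_on {0..t}"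
    and lint: "(LINT s:{0..t}|lborel. k (t - s) * f s) = I t"
    using set_borel_integral_eq_integral[OF kf] by (auto simp: I_def)
  have f': "f integrable_on {0..t}"
    using set_borel_integral_eq_integral(1)[OF f] .
  have f_int: "f integrable_on {p..q}" if "0 \<le> p" "q \<le> t" for p q
    by (rule integrable_on_subinterval[OF f']) (use that in auto)
  have incr: "integral {p..q} f = w q - w p" if "0 \<le> p" "p \<le> q" "q \<le> t" for p q
    using Henstock_Kurzweil_Integration.integral_combine[of 0 p q f] f_int[of 0 q] w[of p] w[of q] that
    by auto
  \<comment> \<open>The mean value theorem gives weight \<open>k t\<close> to the increment of
    \<open>w\<close> up to \<open>c\<close> and weight \<open>k e\<close> to the one from
    \<open>c\<close> to \<open>t - e\<close>. Extending the latter to \<open>t\<close> costs at most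
    \<open>B * (e * k e)\<close>, and lowering its weight to \<open>k t\<close> is allowed because
    \<open>w c \<le> w t\<close>.\<close>
  have lower: "k t * (w t - w 0) \<le> I (t - e) + B * (e * k e)" if e: "0 < e" "e < t - a" for e
  proof -
    have "0 \<le> t - e" using e a by simp
    moreover have "f integrable_on {0..t - e}" using e by (intro f_int) auto
    moreover have "k (t - x) \<le> k (t - y)" if "x \<le> y" "y \<le> t - e" for x y
      using that e by (intro kernel_decreasing) auto
    ultimately obtain c where c: "c \<in> {0..t - e}"
      and "((\<lambda>x. k (t - x) * f x) has_integral
        k (t - 0) * integral {0..c} f + k (t - (t - e)) * integral {c..t - e} f) {0..t - e}"
      using second_mean_value_theorem_full[of f 0 "t - e" "\<lambda>x. k (t - x)"] by blast
    then have "I (t - e) = k t * integral {0..c} f + k e * integral {c..t - e} f"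
      unfolding I_def by (simp add: integral_unique)
    also have "\<dots> = k t * (w c - w 0) + k e * (w t - w c) - k e * (w t - w (t - e))"
      using c e by (simp add: incr algebra_simps)
    finally have I: "I (t - e) = k t * (w c - w 0) + k e * (w t - w c) - k e * (w t - w (t - e))" .
    have "k t * (w t - w c) \<le> k e * (w t - w c)"
      using max[of c] c e a by (intro mult_right_mono kernel_decreasing) auto
    moreover have "w t - w (t - e) \<le> B * e"
    proof -
      have "w t - w (t - e) = integral {t - e..t} f" using e a by (simp add: incr)
      also have "\<dots> \<le> integral {t - e..t} (\<lambda>_. B)"
        using e a B by (intro integral_le f_int) (force simp: abs_le_iff)+
      finally show ?thesis using e by (simp add: mult.commute)
    qed
    then have "k e * (w t - w (t - e)) \<le> k e * (B * e)"
      by (intro mult_left_mono kernel_nonneg)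
    ultimately show ?thesis unfolding I by (simp add: algebra_simps)
  qed
  have "continuous_on {0..t} I"
    unfolding I_def by (intro indefinite_integral_continuous_1 kf')
  then have "(I \<longlongrightarrow> I t) (at t within {0..t})"
    unfolding continuous_on_def by (rule bspec) (use a in auto)
  then have "(I \<longlongrightarrow> I t) (at_left t)"
    using a by (simp add: at_within_Icc_at_left)
  then have "((\<lambda>e. I (t - e)) \<longlongrightarrow> I t) (at_right 0)"
    by (rule filterlim_compose) (auto simp: filterlim_at intro!: tendsto_eq_intros eventually_at_rightI[of 0 1])
  then have "((\<lambda>e. I (t - e) + B * (e * k e)) \<longlongrightarrow> I t + B * 0) (at_right 0)"
    by (intro tendsto_intros kernel_vanishing_moment)
  moreover have "\<forall>\<^sub>F e in at_right 0. k t * (w t - w 0) \<le> I (t - e) + B * (e * k e)"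
    using lower a by (auto intro!: eventually_at_rightI[of 0 "t - a"])
  ultimately have "k t * (w t - w 0) \<le> I t + B * 0"
    by (intro tendsto_lowerbound[where F = "at_right (0::real)"]) auto
  then show ?thesis unfolding lint by simp
qed

end

section \<open>Integrals of delayed functions\<close>

lemma lborel_integral_delay:
  fixes F :: "real \<Rightarrow> real"
  assumes "0 \<le> h"
  shows "(LINT s:{0..t}|lborel. (if s < h then 0 else F (s - h))) = (LINT s:{0..t - h}|lborel. F s)"
proof -
  have "(LINT s:{0..t - h}|lborel. F s) = (LINT s|lborel. indicator {0..t - h} (- h + 1 * s) *\<^sub>R F (- h + 1 * s))"
    unfolding set_lebesgue_integral_def
    using lborel_integral_real_affine[of 1 "\<lambda>s. indicator {0..t - h} s *\<^sub>R F s" "- h"] by simp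
  also have "\<dots> = (LINT s:{0..t}|lborel. (if s < h then 0 else F (s - h)))"
    unfolding set_lebesgue_integral_def
    using assms by (intro Bochner_Integration.integral_cong) (auto simp: indicator_def)
  finally show ?thesis ..
qed

lemma set_integrable_delay:
  fixes F :: "real \<Rightarrow> real"
  assumes "0 \<le> h" "set_integrable lborel {0..t - h} F"
  shows "set_integrable lborel {0..t} (\<lambda>s. if s < h then 0 else F (s - h))"
proof -
  have "integrable lborel (\<lambda>s. indicator {0..t - h} (- h + 1 * s) *\<^sub>R F (- h + 1 * s))"
    using assms(2) unfolding set_integrable_def by (intro lborel_integrable_real_affine) auto
  also have "(\<lambda>s. indicator {0..t - h} (- h + 1 * s) *\<^sub>R F (- h + 1 * s))
      = (\<lambda>s. indicator {0..t} s *\<^sub>R (if s < h then 0 else F (s - h)))"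
    using assms(1) by (auto simp: indicator_def)
  finally show ?thesis by (simp add: set_integrable_def)
qed

section \<open>Sign, monotonicity and bounds for solutions of the scalar equation\<close>

locale relaxation = memory_kernel k for k +
  fixes lam :: real and u f :: "real \<Rightarrow> real"
  assumes lam_pos: "0 < lam"
    and u_continuous: "continuous_on {0..} u"
    and f_continuous: "continuous_on {0<..} f"
    and u_deriv: "\<And>t. 0 < t \<Longrightarrow> (u has_real_derivative f t) (at t)"
    and f_integrable: "\<And>t. 0 < t \<Longrightarrow> set_integrable lborel {0..t} f"
    and equation: "\<And>t. 0 < t \<Longrightarrow> (LINT s:{0..t}|lborel. k (t - s) * f s) = - lam * u t"
begin

lemma relaxation_uminus: "relaxation k lam (\<lambda>t. - u t) (\<lambda>t. - f t)"
proof unfold_locales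
  fix t :: real assume t: "0 < t"
  show "((\<lambda>t. - u t) has_real_derivative - f t) (at t)"
    using u_deriv[OF t] by (rule DERIV_minus)
  show "set_integrable lborel {0..t} (\<lambda>t. - f t)"
    using f_integrable[OF t] by (simp add: set_integrable_def)
  show "(LINT s:{0..t}|lborel. k (t - s) * - f s) = - lam * - u t"
    using equation[OF t] by (simp add: set_lebesgue_integral_def)
qed (use lam_pos u_continuous f_continuous in \<open>auto intro: continuous_intros\<close>)

lemma f_bounded:
  assumes "0 < a"
  obtains B where "\<And>s. s \<in> {a..t} \<Longrightarrow> \<bar>f s\<bar> \<le> B"
proof -
  have "compact (f ` {a..t})"
    by (rule compact_continuous_image[OF continuous_on_subset[OF f_continuous]]) (use assms in auto)
  from compact_imp_bounded[OF this, unfolded bounded_iff]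
  obtain B where "\<forall>y\<in>f ` {a..t}. norm y \<le> B" ..
  then show thesis by (intro that[of B]) auto
qed

lemma integral_f:
  assumes "0 \<le> p" "p \<le> q"
  shows "integral {p..q} f = u q - u p"
proof (rule integral_unique, rule fundamental_theorem_of_calculus_interior[OF assms(2)])
  show "continuous_on {p..q} u"
    by (rule continuous_on_subset[OF u_continuous]) (use assms in auto)
  show "(u has_vector_derivative f x) (at x)" if "x \<in> {p<..<q}" for x
    using u_deriv[of x] that assms by (simp add: has_real_derivative_iff_has_vector_derivative)
qed

text \<open>At a maximum point \<open>m\<close> with \<open>u m > u 0\<close> the maximum principle
  makes the convolution nonnegative, while the equation makes it
  \<open>- lam * u m < 0\<close>.\<close>

lemma maximum_le_initial:
  assumes "0 \<le> u 0" "0 \<le> t"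
  shows "u t \<le> u 0"
proof (rule ccontr)
  assume neg: "\<not> u t \<le> u 0"
  have "continuous_on {0..t} u"
    by (rule continuous_on_subset[OF u_continuous]) auto
  then obtain m where m: "m \<in> {0..t}" "\<And>s. s \<in> {0..t} \<Longrightarrow> u s \<le> u m"
    using continuous_attains_sup[of "{0..t}" u] assms by auto
  have um: "u 0 < u m" using m(2)[of t] neg assms(2) by simp
  then have m0: "0 < m" using m(1) by (cases "m = 0") auto
  obtain B where B: "\<And>s. s \<in> {m / 2..m} \<Longrightarrow> \<bar>f s\<bar> \<le> B"
    using f_bounded[of "m / 2" m] m0 by (metis half_gt_zero)
  have "k m * (u m - u 0) \<le> (LINT s:{0..m}|lborel. k (m - s) * f s)"
    using m m0 by (intro maximum_principle[of "m / 2" _ _ B] B f_integrable) (auto simp: integral_f)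
  then have "k m * (u m - u 0) \<le> - lam * u m"
    using equation[OF m0] by simp
  moreover have "0 \<le> k m * (u m - u 0)"
    using um by (simp add: kernel_nonneg)
  moreover have "0 < lam * u m" using lam_pos um assms(1) by simp
  ultimately show False by simp
qed

text \<open>A negative minimum of \<open>u\<close> is a positive maximum of \<open>- u\<close>,
  where the maximum principle and the equation for \<open>- u\<close> demand opposite signs.\<close>

lemma solution_nonneg:
  assumes "0 \<le> u 0" "0 \<le> t"
  shows "0 \<le> u t"
proof (rule ccontr)
  assume neg: "\<not> 0 \<le> u t"
  interpret minus: relaxation k lam "\<lambda>t. - u t" "\<lambda>t. - f t"
    by (rule relaxation_uminus)
  have "continuous_on {0..t} u"
    by (rule continuous_on_subset[OF u_continuous]) auto
  then obtain m where m: "m \<in> {0..t}" "\<And>s. s \<in> {0..t} \<Longrightarrow> u m \<le> u s"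
    using continuous_attains_inf[of "{0..t}" u] assms by auto
  have um: "u m < 0" using m(2)[of t] neg assms(2) by simp
  then have m0: "0 < m" using m(1) assms(1) by (cases "m = 0") auto
  obtain B where B: "\<And>s. s \<in> {m / 2..m} \<Longrightarrow> \<bar>- f s\<bar> \<le> B"
    using minus.f_bounded[of "m / 2" m] m0 by (metis half_gt_zero)
  have "k m * (- u m - - u 0) \<le> (LINT s:{0..m}|lborel. k (m - s) * - f s)"
    using m m0 by (intro maximum_principle[of "m / 2" _ _ B] B minus.f_integrable)
      (auto simp: integral_f)
  then have "k m * (- u m - - u 0) \<le> lam * u m"
    using minus.equation[OF m0] by simp
  moreover have "0 \<le> k m * (- u m - - u 0)"
    using um assms(1) by (intro mult_nonneg_nonneg kernel_nonneg) simp
  moreover have "lam * u m < 0" using lam_pos um by (simp add: mult_pos_neg)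
  ultimately show False by simp
qed

text \<open>Delaying the solution by \<open>h\<close>, with the initial value as its past, and subtracting it leaves a
  solution of the same equation which is nonpositive on \<open>[0, h]\<close>.\<close>

lemma solution_decreasing:
  assumes u0: "0 \<le> u 0" and "0 \<le> p" "p \<le> q"
  shows "u q \<le> u p"
proof (cases "p = q")
  case False
  define h where "h = q - p"
  have h: "0 < h" using False assms by (simp add: h_def)
  define d where "d s = (if s < h then 0 else f (s - h))" for s
  define w where "w s = u s - u (max 0 (s - h))" for s
  have f_int: "set_integrable lborel {0..t} f" if "0 \<le> t" for t
    using f_integrable[of "t + 1"] by (rule set_integrable_subset) (use that in auto)
  have d_int: "set_integrable lborel {0..t} d" for t
  proof -
    have "set_integrable lborel {0..t - h} f"
    proof (cases "0 \<le> t - h")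
      case False
      then show ?thesis by (simp add: set_integrable_def)
    qed (rule f_int)
    then show ?thesis
      unfolding d_def using h by (intro set_integrable_delay) auto
  qed
  have d_integral: "(LINT s:{0..t}|lborel. d s) = u (max 0 (t - h)) - u 0" for t
  proof (cases "0 \<le> t - h")
    case True
    then show ?thesis
      unfolding d_def using h set_borel_integral_eq_integral(2)[OF f_int[OF True]]
      by (simp add: lborel_integral_delay integral_f)
  next
    case False
    then show ?thesis
      unfolding d_def lborel_integral_delay[OF less_imp_le[OF h]]
      by (simp add: set_lebesgue_integral_def)
  qed
  have w_early: "w s \<le> 0" if "0 \<le> s" "s \<le> h" for s
    using maximum_le_initial[OF u0 that(1)] that by (simp add: w_def max_def)
  have "w q \<le> 0"
  proof (rule ccontr)
    assume neg: "\<not> w q \<le> 0"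
    have "continuous_on {0..q} w"
      unfolding w_def
      by (intro continuous_intros continuous_on_compose2[OF u_continuous]) auto
    then obtain m where m: "m \<in> {0..q}" "\<And>s. s \<in> {0..q} \<Longrightarrow> w s \<le> w m"
      using continuous_attains_sup[of "{0..q}" w] assms by auto
    have wm: "0 < w m" using m(2)[of q] neg assms by simp
    then have mh: "h < m" using w_early[of m] m(1) by force
    \<comment> \<open>A point strictly between \<open>h\<close> and \<open>m\<close>: on
      \<open>[a, m]\<close> both \<open>f\<close> and its delayed copy are evaluated at times
      bounded away from zero, where \<open>f\<close> is bounded.\<close>
    define a where "a = (m + h) / 2"
    have a: "0 < a" "h < a" "a < m" using h mh by (auto simp: a_def)
    obtain B where B: "\<And>s. s \<in> {a..m} \<Longrightarrow> \<bar>f s\<bar> \<le> B"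
      using f_bounded[OF a(1)] by blast
    obtain B' where B': "\<And>s. s \<in> {a - h..m - h} \<Longrightarrow> \<bar>f s\<bar> \<le> B'"
      using f_bounded[of "a - h" "m - h"] a by (metis diff_gt_0_iff_gt)
    have bound: "\<bar>f s\<bar> \<le> B" "\<bar>d s\<bar> \<le> B'" if "s \<in> {a..m}" for s
      using B[OF that] B'[of "s - h"] that a by (auto simp: d_def)
    have g_int: "set_integrable lborel {0..s} (\<lambda>s. f s - d s)" if "0 \<le> s" for s
      using f_int[OF that] d_int by (rule set_integral_diff)
    have "k m * (w m - w 0) \<le> (LINT s:{0..m}|lborel. k (m - s) * (f s - d s))"
    proof (rule maximum_principle[of a _ _ "B + B'"])
      fix s assume s: "0 \<le> s" "s \<le> m"
      have "integral {0..s} (\<lambda>s. f s - d s) = (LINT s:{0..s}|lborel. f s) - (LINT s:{0..s}|lborel. d s)"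
        using set_borel_integral_eq_integral(2)[OF g_int[OF s(1)]] set_integral_diff(2)[OF f_int[OF s(1)] d_int]
        by simp
      also have "\<dots> = w s - w 0"
        using set_borel_integral_eq_integral(2)[OF f_int[OF s(1)]] s h d_integral[of s]
        by (simp add: integral_f w_def)
      finally show "w s = w 0 + integral {0..s} (\<lambda>s. f s - d s)" by simp
      show "w s \<le> w m" using m s by simp
    next
      fix s assume "s \<in> {a..m}"
      then show "\<bar>f s - d s\<bar> \<le> B + B'"
        using bound[of s] by linarith
    qed (use a g_int in auto)
    also have "\<dots> = (LINT s:{0..m}|lborel. k (m - s) * f s) - (LINT s:{0..m}|lborel. k (m - s) * d s)"
    proof -
      have kf: "set_integrable lborel {0..m} (\<lambda>s. k (m - s) * f s)"
        using convolution_integrable[of a m f B] bound a f_int by simp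
      have kd: "set_integrable lborel {0..m} (\<lambda>s. k (m - s) * d s)"
        using convolution_integrable[of a m d B'] bound a d_int by simp
      show ?thesis
        using set_integral_diff(2)[OF kf kd] by (simp add: algebra_simps)
    qed
    \<comment> \<open>Since \<open>d\<close> vanishes before \<open>h\<close>, its convolution at
      \<open>m\<close> is that of \<open>f\<close> at \<open>m - h\<close>, so the equation can be
      used at both times.\<close>
    also have "(LINT s:{0..m}|lborel. k (m - s) * d s) = (LINT s:{0..m - h}|lborel. k ((m - h) - s) * f s)"
    proof -
      have "k (m - s) * d s = (if s < h then 0 else k (m - h - (s - h)) * f (s - h))" for s
        by (simp add: d_def)
      then show ?thesis
        using lborel_integral_delay[of h m "\<lambda>s. k (m - h - s) * f s"] h by simp
    qed
    also have "(LINT s:{0..m}|lborel. k (m - s) * f s) - \<dots> = - lam * w m"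
      using equation[of m] equation[of "m - h"] h mh by (simp add: w_def algebra_simps)
    finally have "k m * (w m - w 0) \<le> - lam * w m" .
    moreover have "0 \<le> k m * (w m - w 0)"
      using wm h by (simp add: kernel_nonneg w_def)
    moreover have "0 < lam * w m" using lam_pos wm by simp
    ultimately show False by simp
  qed
  then show ?thesis using assms by (simp add: w_def h_def)
qed simp

lemma derivative_nonpos:
  assumes "0 \<le> u 0" "0 < t"
  shows "f t \<le> 0"
proof -
  have "mono_on {0<..} (\<lambda>s. - u s)"
    using solution_decreasing[OF assms(1)] by (auto intro!: mono_onI)
  then have "0 \<le> - f t"
    using mono_on_imp_deriv_nonneg[OF _ DERIV_minus[OF u_deriv[OF assms(2)]], of "{0<..}"] assms(2)
    by (simp add: interior_open)
  then show ?thesis by simp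
qed

text \<open>As \<open>u\<close> decreases, every \<open>t\<close> is a maximum point of
  \<open>- u\<close> on \<open>[0, t]\<close>, so the maximum principle applies at all times and not
  only at an extremum chosen for a contradiction.\<close>

lemma solution_lower_bound:
  assumes u0: "0 \<le> u 0" and t: "0 < t"
  shows "k t * (u 0 - u t) \<le> lam * u t"
proof -
  interpret minus: relaxation k lam "\<lambda>t. - u t" "\<lambda>t. - f t"
    by (rule relaxation_uminus)
  obtain B where B: "\<And>s. s \<in> {t / 2..t} \<Longrightarrow> \<bar>- f s\<bar> \<le> B"
    using minus.f_bounded[of "t / 2" t] t by (metis half_gt_zero)
  have "k t * (- u t - - u 0) \<le> (LINT s:{0..t}|lborel. k (t - s) * - f s)"
    using t solution_decreasing[OF u0]
    by (intro maximum_principle[of "t / 2" _ _ B] B minus.f_integrable) (auto simp: integral_f)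
  then show ?thesis using minus.equation[OF t] by simp
qed

text \<open>The equation integrated over \<open>[\<sigma>, T]\<close>; the mass \<open>- f\<close> of \<open>[0, A]\<close> sees only the kernel
  beyond \<open>\<sigma> - A\<close>, the small mass of \<open>[A, T]\<close> at most the whole kernel.\<close>

lemma averaged_upper_bound:
  assumes u0: "0 \<le> u 0" and A: "0 \<le> A" "A < \<sigma>" "\<sigma> < T"
  shows "lam * (T - \<sigma>) * u T \<le>
    (T - \<sigma>) * k (\<sigma> - A) * (u 0 - u A) + (LINT r:{0..T}|lborel. k r) * (u A - u T)"
proof -
  define K where "K = (LINT r:{0..T}|lborel. k r)"
  \<comment> \<open>All integrals below are nonnegative ones, so exchanging their order needs only
    measurability. The cut to positive times is made because the sign and the continuity of
    \<open>f\<close> are known only there; the point 0 is null.\<close>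
  define g where "g s = indicator {0<..} s *\<^sub>R (- f s)" for s
  have g_nonneg: "0 \<le> g s" for s
    using derivative_nonpos[OF u0, of s] by (auto simp: g_def indicator_def)
  have [measurable]: "g \<in> borel_measurable borel"
    unfolding g_def
    by (intro borel_measurable_continuous_on_indicator continuous_intros f_continuous) auto
  have ae: "AE s in lborel. s \<noteq> (0::real)" by (rule AE_lborel_singleton)
  have f_int: "set_integrable lborel {p..q} f" if "0 \<le> p" for p q
    using f_integrable[of "max 1 q"] by (rule set_integrable_subset) (use that in auto)
  have nn_g: "(\<integral>\<^sup>+s. indicator {p..q} s * ennreal (g s) \<partial>lborel) = ennreal (u p - u q)"
    if "0 \<le> p" "p \<le> q" for p q
  proof -
    have "(\<integral>\<^sup>+s. indicator {p..q} s * ennreal (g s) \<partial>lborel)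
        = (\<integral>\<^sup>+s. ennreal (- (indicator {p..q} s *\<^sub>R f s)) \<partial>lborel)"
      by (rule nn_integral_cong_AE, use ae in eventually_elim) (use that in \<open>auto simp: g_def indicator_def\<close>)
    also have "\<dots> = ennreal (LINT s|lborel. - (indicator {p..q} s *\<^sub>R f s))"
    proof (rule nn_integral_eq_integral)
      show "integrable lborel (\<lambda>s. - (indicator {p..q} s *\<^sub>R f s))"
        using f_int[OF that(1)] by (simp add: set_integrable_def)
      show "AE s in lborel. 0 \<le> - (indicator {p..q} s *\<^sub>R f s)"
        using ae by eventually_elim (use that derivative_nonpos[OF u0] in \<open>auto simp: indicator_def\<close>)
    qed
    also have "(LINT s|lborel. - (indicator {p..q} s *\<^sub>R f s)) = - integral {p..q} f"
      using set_borel_integral_eq_integral(2)[OF f_int[OF that(1)]]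
      by (simp add: set_lebesgue_integral_def)
    finally show ?thesis using that by (simp add: integral_f)
  qed
  have nn_eq: "ennreal (lam * u t) = (\<integral>\<^sup>+s. indicator {0..t} s * ennreal (k (t - s) * g s) \<partial>lborel)"
    if t: "0 < t" for t
  proof -
    obtain B where B: "\<And>s. s \<in> {t / 2..t} \<Longrightarrow> \<bar>f s\<bar> \<le> B"
      using f_bounded[of "t / 2" t] t by (metis half_gt_zero)
    have kf: "set_integrable lborel {0..t} (\<lambda>s. k (t - s) * f s)"
      using convolution_integrable[of "t / 2" t f B] B t f_int by simp
    have "(\<integral>\<^sup>+s. indicator {0..t} s * ennreal (k (t - s) * g s) \<partial>lborel)
        = (\<integral>\<^sup>+s. ennreal (- (indicator {0..t} s *\<^sub>R (k (t - s) * f s))) \<partial>lborel)"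
      by (rule nn_integral_cong_AE, use ae in eventually_elim) (auto simp: g_def indicator_def)
    also have "\<dots> = ennreal (LINT s|lborel. - (indicator {0..t} s *\<^sub>R (k (t - s) * f s)))"
    proof (rule nn_integral_eq_integral)
      show "integrable lborel (\<lambda>s. - (indicator {0..t} s *\<^sub>R (k (t - s) * f s)))"
        using kf by (simp add: set_integrable_def)
      show "AE s in lborel. 0 \<le> - (indicator {0..t} s *\<^sub>R (k (t - s) * f s))"
        using ae
      proof eventually_elim
        case (elim s)
        have "k (t - s) * f s \<le> 0" if "0 < s"
          using derivative_nonpos[OF u0 that] kernel_nonneg by (simp add: mult_nonneg_nonpos)
        then show ?case using elim by (cases "s \<in> {0..t}") simp_all
      qed
    qed
    also have "(LINT s|lborel. - (indicator {0..t} s *\<^sub>R (k (t - s) * f s))) = lam * u t"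
      using equation[OF t] by (simp add: set_lebesgue_integral_def)
    finally show ?thesis ..
  qed
  have uT: "u T \<le> u t" if "t \<in> {\<sigma>..T}" for t
    using that A by (intro solution_decreasing[OF u0]) auto
  have uT0: "0 \<le> u T" using A by (intro solution_nonneg[OF u0]) auto
  \<comment> \<open>Integrated over \<open>s\<close> this gives \<open>lam * u t\<close> for
    \<open>t\<close> in \<open>[\<sigma>, T]\<close>; integrating over \<open>t\<close> first
    exposes how much kernel each portion of the mass of \<open>g\<close> meets.\<close>
  define h where "h t s = (if 0 \<le> s \<and> s \<le> t \<and> \<sigma> \<le> t \<and> t \<le> T then ennreal (k (t - s) * g s) else 0)"
    for t s
  have [measurable]: "case_prod h \<in> borel_measurable (lborel \<Otimes>\<^sub>M lborel)"
    unfolding h_def by measurable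
  have nn_K: "(\<integral>\<^sup>+r. indicator {0..T} r * ennreal (k r) \<partial>lborel) = ennreal K"
  proof -
    have "(\<integral>\<^sup>+r. indicator {0..T} r * ennreal (k r) \<partial>lborel)
        = (\<integral>\<^sup>+r. ennreal (indicator {0..T} r *\<^sub>R k r) \<partial>lborel)"
      by (intro nn_integral_cong) (auto simp: indicator_def)
    also have "\<dots> = ennreal K"
      unfolding K_def set_lebesgue_integral_def
      using integrable_kernel[of T] unfolding set_integrable_def
      by (intro nn_integral_eq_integral) (auto simp: kernel_nonneg)
    finally show ?thesis .
  qed
  have K: "0 \<le> K"
    unfolding K_def set_lebesgue_integral_def by (simp add: kernel_nonneg)
  have inner: "(\<integral>\<^sup>+t. h t s \<partial>lborel) \<le>
      indicator {0..A} s * ennreal (g s) * ennreal ((T - \<sigma>) * k (\<sigma> - A))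
        + indicator {A..T} s * ennreal (g s) * ennreal K" (is "_ \<le> ?R s") for s
  proof -
    consider "s < 0 \<or> T < s" | "0 \<le> s" "s \<le> A" | "A < s" "s \<le> T" by linarith
    then show ?thesis
    proof cases
      case 1
      then have "h t s = 0" for t by (auto simp: h_def)
      then show ?thesis by simp
    next
      case 2
      have "(\<integral>\<^sup>+t. h t s \<partial>lborel) \<le> (\<integral>\<^sup>+t. ennreal (k (\<sigma> - A) * g s) * indicator {\<sigma>..T} t \<partial>lborel)"
      proof (rule nn_integral_mono)
        fix t
        have "k (t - s) * g s \<le> k (\<sigma> - A) * g s" if "\<sigma> \<le> t"
          using that 2 A g_nonneg by (intro mult_right_mono kernel_decreasing) auto
        then show "h t s \<le> ennreal (k (\<sigma> - A) * g s) * indicator {\<sigma>..T} t"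
          by (auto simp: h_def intro: ennreal_leI)
      qed
      also have "\<dots> = ennreal (k (\<sigma> - A) * g s) * ennreal (T - \<sigma>)"
        using A by (simp add: nn_integral_cmult_indicator)
      also have "\<dots> = ennreal (g s) * ennreal ((T - \<sigma>) * k (\<sigma> - A))"
        using A g_nonneg kernel_nonneg by (simp add: ennreal_mult[symmetric] mult.commute mult.left_commute)
      also have "\<dots> \<le> ?R s" using 2 by (simp add: indicator_def)
      finally show ?thesis .
    next
      case 3
      have "(\<integral>\<^sup>+t. h t s \<partial>lborel)
          \<le> (\<integral>\<^sup>+t. ennreal (g s) * (indicator {0..T} (- s + 1 * t) * ennreal (k (- s + 1 * t))) \<partial>lborel)"
      proof (rule nn_integral_mono)
        fix t
        show "h t s \<le> ennreal (g s) * (indicator {0..T} (- s + 1 * t) * ennreal (k (- s + 1 * t)))"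
          using 3 A g_nonneg kernel_nonneg by (auto simp: h_def ennreal_mult[symmetric] mult.commute)
      qed
      also have "\<dots> = ennreal (g s) *
          (\<integral>\<^sup>+t. indicator {0..T} (- s + 1 * t) * ennreal (k (- s + 1 * t)) \<partial>lborel)"
        by (intro nn_integral_cmult) measurable
      also have "(\<integral>\<^sup>+t. indicator {0..T} (- s + 1 * t) * ennreal (k (- s + 1 * t)) \<partial>lborel) = ennreal K"
        using nn_integral_real_affine[of "\<lambda>r. indicator {0..T} r * ennreal (k r)" 1 "- s"] nn_K by simp
      also have "ennreal (g s) * ennreal K \<le> ?R s" using 3 by (simp add: indicator_def)
      finally show ?thesis .
    qed
  qed
  have "ennreal (lam * (T - \<sigma>) * u T) = (\<integral>\<^sup>+t. ennreal (lam * u T) * indicator {\<sigma>..T} t \<partial>lborel)"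
    using A lam_pos uT0 by (simp add: nn_integral_cmult_indicator ennreal_mult[symmetric] mult_ac)
  also have "\<dots> \<le> (\<integral>\<^sup>+t. \<integral>\<^sup>+s. h t s \<partial>lborel \<partial>lborel)"
  proof (rule nn_integral_mono)
    fix t
    show "ennreal (lam * u T) * indicator {\<sigma>..T} t \<le> (\<integral>\<^sup>+s. h t s \<partial>lborel)"
    proof (cases "t \<in> {\<sigma>..T}")
      case True
      then have "ennreal (lam * u T) \<le> ennreal (lam * u t)"
        using lam_pos uT by (intro ennreal_leI mult_left_mono) auto
      also have "\<dots> = (\<integral>\<^sup>+s. h t s \<partial>lborel)"
        using True A by (subst nn_eq) (auto simp: h_def indicator_def intro!: nn_integral_cong)
      finally show ?thesis using True by simp
    qed simp
  qed
  also have "\<dots> = (\<integral>\<^sup>+s. \<integral>\<^sup>+t. h t s \<partial>lborel \<partial>lborel)"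
    by (rule lborel_pair.Fubini'[symmetric]) measurable
  also have "\<dots> \<le> (\<integral>\<^sup>+s. indicator {0..A} s * ennreal (g s) * ennreal ((T - \<sigma>) * k (\<sigma> - A))
        + indicator {A..T} s * ennreal (g s) * ennreal K \<partial>lborel)"
    by (intro nn_integral_mono inner)
  also have "\<dots> = ennreal (u 0 - u A) * ennreal ((T - \<sigma>) * k (\<sigma> - A)) + ennreal (u A - u T) * ennreal K"
    using A by (simp add: nn_integral_add nn_integral_multc nn_g)
  also have "\<dots> = ennreal ((T - \<sigma>) * k (\<sigma> - A) * (u 0 - u A) + K * (u A - u T))"
    using A K kernel_nonneg[of "\<sigma> - A"] solution_decreasing[OF u0, of 0 A] solution_decreasing[OF u0, of A T]
    by (simp add: ennreal_mult[symmetric] ennreal_plus[symmetric] mult.commute del: ennreal_plus)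
  finally show ?thesis
    unfolding K_def[symmetric]
    by (rule iffD1[OF ennreal_le_iff, rotated])
      (use A K kernel_nonneg[of "\<sigma> - A"] solution_decreasing[OF u0, of 0 A] solution_decreasing[OF u0, of A T] in auto)
qed

end

section \<open>Solutions are asymptotic to a multiple of the kernel\<close>

locale regular_kernel = memory_kernel k for k +
  fixes C :: real
  assumes kernel_pos: "\<And>r. 0 < r \<Longrightarrow> 0 < k r"
    and kernel_tendsto_0: "(k \<longlongrightarrow> 0) at_top"
    and kernel_dilation: "\<And>q r. 1 \<le> q \<Longrightarrow> 0 < r \<Longrightarrow> k (r / q) \<le> q * k r"
    and kernel_average: "\<And>T. 1 \<le> T \<Longrightarrow> (LINT r:{0..T}|lborel. k r) \<le> C * T * k T"

locale regular_relaxation = regular_kernel k C + relaxation k lam u f for k C lam u f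
begin

text \<open>The averaged bound with \<open>A = 0\<close> and \<open>\<sigma> = T / 2\<close>, where
  the first term drops out, gives a crude bound by a multiple of \<open>k T\<close>. It serves to
  make the mass left after a fixed fraction of \<open>T\<close> negligible.\<close>

lemma solution_tendsto_0:
  assumes u0: "0 \<le> u 0"
  shows "(u \<longlongrightarrow> 0) at_top"
proof (rule tendsto_sandwich[OF _ _ tendsto_const])
  show "((\<lambda>T. 2 * C * u 0 / lam * k T) \<longlongrightarrow> 0) at_top"
    by (rule tendsto_mult_right_zero[OF kernel_tendsto_0])
  show "\<forall>\<^sub>F T in at_top. 0 \<le> u T"
    using solution_nonneg[OF u0] by (auto intro!: eventually_at_top_linorderI[of 0])
  have "u T \<le> 2 * C * u 0 / lam * k T" if T: "1 \<le> T" for T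
  proof -
    have "lam * (T - T / 2) * u T \<le> (LINT r:{0..T}|lborel. k r) * (u 0 - u T)"
      using averaged_upper_bound[OF u0, of 0 "T / 2" T] T by simp
    also have "\<dots> \<le> (LINT r:{0..T}|lborel. k r) * u 0"
      using solution_nonneg[OF u0, of T] T
      by (intro mult_left_mono) (auto simp: set_lebesgue_integral_def kernel_nonneg)
    also have "\<dots> \<le> C * T * k T * u 0"
      by (intro mult_right_mono kernel_average T u0)
    finally have "T * (lam * u T) \<le> T * (2 * C * u 0 * k T)" by (simp add: algebra_simps)
    then have "lam * u T \<le> 2 * C * u 0 * k T" using T by simp
    then show ?thesis using lam_pos by (simp add: field_simps)
  qed
  then show "\<forall>\<^sub>F T in at_top. u T \<le> 2 * C * u 0 / lam * k T"
    by (auto intro!: eventually_at_top_linorderI[of 1])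
qed

text \<open>The averaged bound with \<open>A = e * T\<close> and
  \<open>\<sigma> = (1 - e) * T\<close>. The value of \<open>e\<close> is chosen so that
  \<open>\<sigma> - A = T / q\<close>, where the dilation bound costs only the factor
  \<open>q\<close>.\<close>

lemma solution_upper_bound:
  assumes u0: "0 \<le> u 0" and q: "1 < q" and T: "1 \<le> T"
  defines "e \<equiv> (1 - 1 / q) / 2"
  shows "u T / k T \<le> (q * u 0 + C / e * u (e * T)) / lam"
proof -
  have e: "0 < e" "e < 1 / 2" using q by (auto simp: e_def)
  have kT: "0 < k T" using T by (intro kernel_pos) auto
  have sum: "T - (1 - e) * T = e * T" "(1 - e) * T - e * T = T / q"
    using q by (auto simp: e_def field_simps)
  have uA: "0 \<le> u (e * T)" "0 \<le> u T"
    using e T by (auto intro: solution_nonneg[OF u0])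
  have "lam * (e * T) * u T
      \<le> e * T * k (T / q) * (u 0 - u (e * T)) + (LINT r:{0..T}|lborel. k r) * (u (e * T) - u T)"
    using averaged_upper_bound[OF u0, of "e * T" "(1 - e) * T" T] e T unfolding sum by simp
  also have "\<dots> \<le> e * T * (q * k T) * u 0 + (C * T * k T) * u (e * T)"
  proof (intro add_mono)
    have "e * T * k (T / q) * (u 0 - u (e * T)) \<le> e * T * k (T / q) * u 0"
      using uA e T by (intro mult_left_mono mult_nonneg_nonneg kernel_nonneg) auto
    also have "\<dots> \<le> e * T * (q * k T) * u 0"
      using u0 e T q by (intro mult_right_mono mult_left_mono kernel_dilation) auto
    finally show "e * T * k (T / q) * (u 0 - u (e * T)) \<le> e * T * (q * k T) * u 0" .
    have "(LINT r:{0..T}|lborel. k r) * (u (e * T) - u T) \<le> (LINT r:{0..T}|lborel. k r) * u (e * T)"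
      using uA by (intro mult_left_mono) (auto simp: set_lebesgue_integral_def kernel_nonneg)
    also have "\<dots> \<le> (C * T * k T) * u (e * T)"
      by (intro mult_right_mono kernel_average T uA)
    finally show "(LINT r:{0..T}|lborel. k r) * (u (e * T) - u T) \<le> (C * T * k T) * u (e * T)" .
  qed
  also have "\<dots> = (e * T * k T) * (q * u 0 + C / e * u (e * T))"
    using e by (simp add: field_simps)
  finally have "(e * T) * (lam * u T) \<le> (e * T) * (k T * (q * u 0 + C / e * u (e * T)))"
    by (simp add: mult_ac)
  then have "lam * u T \<le> k T * (q * u 0 + C / e * u (e * T))"
    using e T by (simp add: mult_le_cancel_left_pos)
  then show ?thesis
    using kT lam_pos by (simp add: divide_le_eq le_divide_eq mult_ac)
qed

text \<open>The lower bound rearranges to \<open>u 0 / (lam + k t) \<le> u t / k t\<close>, whose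
  left side tends to \<open>u 0 / lam\<close>. In the upper bound the term with
  \<open>u (e * t)\<close> vanishes for fixed \<open>q\<close>, leaving \<open>q * u 0 / lam\<close>
  with \<open>q\<close> as close to 1 as desired.\<close>

lemma solution_asymptotics_nonneg:
  assumes u0: "0 \<le> u 0"
  shows "((\<lambda>t. u t / k t) \<longlongrightarrow> u 0 / lam) at_top"
proof (rule order_tendstoI)
  fix a assume a: "a < u 0 / lam"
  have "((\<lambda>t. u 0 / (lam + k t)) \<longlongrightarrow> u 0 / (lam + 0)) at_top"
    using lam_pos by (intro tendsto_intros kernel_tendsto_0) auto
  then have "\<forall>\<^sub>F t in at_top. a < u 0 / (lam + k t)"
    using a by (intro order_tendstoD) auto
  then show "\<forall>\<^sub>F t in at_top. a < u t / k t"
    using eventually_gt_at_top[of 0]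
  proof eventually_elim
    case (elim t)
    have "k t * u 0 \<le> u t * (lam + k t)"
      using solution_lower_bound[OF u0 elim(2)] by (simp add: algebra_simps)
    then have "u 0 / (lam + k t) \<le> u t / k t"
      using kernel_pos[OF elim(2)] lam_pos by (simp add: divide_le_eq le_divide_eq mult_ac)
    then show ?case using elim(1) by simp
  qed
next
  fix a assume a: "u 0 / lam < a"
  \<comment> \<open>Chosen so that \<open>q * u 0 < a * lam\<close>: the excess
    \<open>(q - 1) * u 0\<close> is a fraction below one half of the gap
    \<open>a * lam - u 0\<close>. The summand 1 in the denominator covers
    \<open>u 0 = 0\<close>.\<close>
  define q where "q = 1 + (a * lam - u 0) / (2 * (u 0 + 1))"
  have gap: "0 < a * lam - u 0" using a lam_pos by (simp add: divide_less_eq)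
  have q: "1 < q" using gap u0 by (simp add: q_def)
  have "q * u 0 = u 0 + (a * lam - u 0) * (u 0 / (2 * (u 0 + 1)))"
    using u0 by (simp add: q_def field_simps)
  also have "\<dots> < u 0 + (a * lam - u 0) * 1"
    using gap u0 by (intro add_strict_left_mono mult_strict_left_mono) (auto simp: divide_less_eq)
  finally have qa: "(q * u 0 + C / ((1 - 1 / q) / 2) * 0) / lam < a"
    using lam_pos by (simp add: divide_less_eq)
  define e where "e = (1 - 1 / q) / 2"
  have e: "0 < e" using q by (simp add: e_def)
  have "filterlim (\<lambda>t. e * t) at_top at_top"
    using e by (intro filterlim_tendsto_pos_mult_at_top[OF tendsto_const]) (auto simp: filterlim_ident)
  then have "((\<lambda>t. u (e * t)) \<longlongrightarrow> 0) at_top"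
    by (rule filterlim_compose[OF solution_tendsto_0[OF u0]])
  then have "((\<lambda>t. (q * u 0 + C / e * u (e * t)) / lam) \<longlongrightarrow> (q * u 0 + C / e * 0) / lam) at_top"
    using lam_pos by (intro tendsto_intros) auto
  then have "\<forall>\<^sub>F t in at_top. (q * u 0 + C / e * u (e * t)) / lam < a"
    using qa unfolding e_def by (intro order_tendstoD(2))
  then show "\<forall>\<^sub>F t in at_top. u t / k t < a"
    using eventually_ge_at_top[of 1]
  proof eventually_elim
    case (elim t)
    then show ?case
      using solution_upper_bound[OF u0 q elim(2)] unfolding e_def by linarith
  qed
qed

lemma solution_asymptotics: "((\<lambda>t. u t / k t) \<longlongrightarrow> u 0 / lam) at_top"
proof (cases "0 \<le> u 0")
  case False
  interpret minus: relaxation k lam "\<lambda>t. - u t" "\<lambda>t. - f t"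
    by (rule relaxation_uminus)
  interpret minus: regular_relaxation k C lam "\<lambda>t. - u t" "\<lambda>t. - f t" ..
  have "((\<lambda>t. - (- u t / k t)) \<longlongrightarrow> - (- u 0 / lam)) at_top"
    using False by (intro tendsto_minus minus.solution_asymptotics_nonneg) auto
  then show ?thesis by simp
qed (rule solution_asymptotics_nonneg)

end


section \<open>The kernel of the fractional operator\<close>

text \<open>The reciprocal Gamma function vanishes at \<open>0\<close>, so a possible mass at \<open>\<alpha> = 1\<close>, where
  \<^term>\<open>r powr (- \<alpha>)\<close> is not integrable, does no harm.\<close>

definition frac_kernel :: "real measure \<Rightarrow> real \<Rightarrow> real" where
  "frac_kernel \<nu> r = (LINT \<alpha>:{0..1}|\<nu>. rGamma (1 - \<alpha>) * r powr (- \<alpha>))"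

lemma rGamma_real_nonneg: "0 \<le> x \<Longrightarrow> 0 \<le> rGamma (x::real)"
  by (cases "x = 0") (auto simp: rGamma_inverse_Gamma intro!: less_imp_le Gamma_real_pos)

lemma continuous_on_rGamma_diff [continuous_intros]:
  "continuous_on A (\<lambda>\<alpha>. rGamma (x - \<alpha> :: real))"
  by (rule continuous_on_compose2[OF continuous_on_rGamma[of UNIV]]) (auto intro: continuous_intros)

text \<open>What both cases share. Absence of mass at order 0 makes the kernel decay; mass on orders
  bounded away from 1, where \<open>rGamma (1 - \<alpha>)\<close> stays positive, bounds the kernel
  from below.\<close>

locale order_measure = finite_measure \<nu> for \<nu> :: "real measure" +
  assumes sets_eq [measurable_cong]: "sets \<nu> = sets borel"
    and null_zero: "emeasure \<nu> {0} = 0"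
    and mass_below_one: "\<exists>\<beta><1. 0 < emeasure \<nu> {0..\<beta>}"
begin

lemma integrable_continuous:
  fixes g :: "real \<Rightarrow> real"
  assumes "continuous_on {0..1} g"
  shows "set_integrable \<nu> {0..1} g"
proof -
  have [measurable]: "(\<lambda>\<alpha>. indicator {0..1} \<alpha> *\<^sub>R g \<alpha>) \<in> borel_measurable borel"
    using assms by (intro borel_measurable_continuous_on_indicator) auto
  have "compact (g ` {0..1})"
    using assms by (intro compact_continuous_image) auto
  from compact_imp_bounded[OF this, unfolded bounded_iff]
  obtain B where "\<forall>y\<in>g ` {0..1}. norm y \<le> B" ..
  then have "\<bar>g \<alpha>\<bar> \<le> max B 0" if "\<alpha> \<in> {0..1}" for \<alpha>
    using that by (auto simp: le_max_iff_disj)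
  then have "AE \<alpha> in \<nu>. norm (indicator {0..1} \<alpha> *\<^sub>R g \<alpha>) \<le> max B 0"
    by (intro AE_I2) (auto simp: indicator_def)
  then show ?thesis
    unfolding set_integrable_def by (rule integrable_const_bound) measurable
qed

lemma integrable_density:
  assumes "0 < r"
  shows "set_integrable \<nu> {0..1} (\<lambda>\<alpha>. rGamma (1 - \<alpha>) * r powr (- \<alpha>))"
  using assms by (intro integrable_continuous continuous_intros) auto

lemma measurable_frac_kernel: "frac_kernel \<nu> \<in> borel_measurable borel"
proof -
  have [measurable]: "(rGamma :: real \<Rightarrow> real) \<in> borel_measurable borel"
    by (intro borel_measurable_continuous_onI continuous_intros)
  show ?thesis
    unfolding frac_kernel_def[abs_def] set_lebesgue_integral_def by measurable
qed

lemma frac_kernel_nonneg: "0 \<le> frac_kernel \<nu> r"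
  unfolding frac_kernel_def set_lebesgue_integral_def
  by (rule Bochner_Integration.integral_nonneg) (auto simp: indicator_def rGamma_real_nonneg)

text \<open>Used with \<open>c = 1\<close> for monotonicity and with \<open>c = q\<close> for the
  dilation bound.\<close>

lemma frac_kernel_mono:
  assumes "0 < r" "0 < s" and "\<And>\<alpha>. \<alpha> \<in> {0..1} \<Longrightarrow> s powr (- \<alpha>) \<le> c * r powr (- \<alpha>)"
  shows "frac_kernel \<nu> s \<le> c * frac_kernel \<nu> r"
proof -
  have "frac_kernel \<nu> s \<le> (LINT \<alpha>:{0..1}|\<nu>. c * (rGamma (1 - \<alpha>) * r powr (- \<alpha>)))"
    unfolding frac_kernel_def
  proof (rule set_integral_mono)
    fix \<alpha> :: real assume "\<alpha> \<in> {0..1}"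
    then have "rGamma (1 - \<alpha>) * s powr (- \<alpha>) \<le> rGamma (1 - \<alpha>) * (c * r powr (- \<alpha>))"
      using assms(3) by (intro mult_left_mono rGamma_real_nonneg) auto
    then show "rGamma (1 - \<alpha>) * s powr (- \<alpha>) \<le> c * (rGamma (1 - \<alpha>) * r powr (- \<alpha>))"
      by (simp add: mult_ac)
  qed (use assms integrable_density in auto)
  then show ?thesis by (simp add: frac_kernel_def)
qed

text \<open>Integrating \<open>r powr (- \<alpha>)\<close> produces the factor
  \<open>1 / (1 - \<alpha>)\<close>, which \<open>rGamma (1 - \<alpha>) = (1 - \<alpha>) * rGamma (2
  - \<alpha>)\<close> cancels, so the bound is uniform up to order 1. At \<open>\<alpha> = 1\<close>
  the left integrand is zero and the right one is not, whence only an inequality.\<close>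

lemma nn_integral_frac_kernel:
  assumes T: "0 < T"
  shows "(\<integral>\<^sup>+r. indicator {0..T} r * ennreal (frac_kernel \<nu> r) \<partial>lborel)
    \<le> ennreal (LINT \<alpha>:{0..1}|\<nu>. rGamma (2 - \<alpha>) * T powr (1 - \<alpha>))"
proof -
  interpret pair_sigma_finite \<nu> lborel ..
  have [measurable]: "(rGamma :: real \<Rightarrow> real) \<in> borel_measurable borel"
    by (intro borel_measurable_continuous_onI continuous_intros)
  define h where "h \<alpha> r = indicator {0..T} r * ennreal (indicator {0..1} \<alpha> * (rGamma (1 - \<alpha>) * r powr (- \<alpha>)))"
    for \<alpha> r :: real
  have [measurable]: "case_prod h \<in> borel_measurable (\<nu> \<Otimes>\<^sub>M lborel)"
    unfolding h_def by measurable
  have "(\<integral>\<^sup>+r. indicator {0..T} r * ennreal (frac_kernel \<nu> r) \<partial>lborel) = (\<integral>\<^sup>+r. \<integral>\<^sup>+\<alpha>. h \<alpha> r \<partial>\<nu> \<partial>lborel)"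
  proof (rule nn_integral_cong_AE, use AE_lborel_singleton[of 0] in eventually_elim)
    fix r :: real assume "r \<noteq> 0"
    show "indicator {0..T} r * ennreal (frac_kernel \<nu> r) = (\<integral>\<^sup>+\<alpha>. h \<alpha> r \<partial>\<nu>)"
    proof (cases "r \<in> {0..T}")
      case True
      then have "0 < r" using \<open>r \<noteq> 0\<close> by simp
      have "(\<integral>\<^sup>+\<alpha>. ennreal (indicator {0..1} \<alpha> *\<^sub>R (rGamma (1 - \<alpha>) * r powr (- \<alpha>))) \<partial>\<nu>)
          = ennreal (frac_kernel \<nu> r)"
        unfolding frac_kernel_def set_lebesgue_integral_def
        using integrable_density[OF \<open>0 < r\<close>] unfolding set_integrable_def
        by (intro nn_integral_eq_integral AE_I2) (auto simp: indicator_def rGamma_real_nonneg)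
      then show ?thesis using True by (simp add: h_def)
    qed (simp add: h_def)
  qed
  also have "\<dots> = (\<integral>\<^sup>+\<alpha>. \<integral>\<^sup>+r. h \<alpha> r \<partial>lborel \<partial>\<nu>)"
    by (rule Fubini') measurable
  also have "\<dots> \<le> (\<integral>\<^sup>+\<alpha>. ennreal (indicator {0..1} \<alpha> *\<^sub>R (rGamma (2 - \<alpha>) * T powr (1 - \<alpha>))) \<partial>\<nu>)"
  proof (rule nn_integral_mono)
    fix \<alpha> :: real
    show "(\<integral>\<^sup>+r. h \<alpha> r \<partial>lborel) \<le> ennreal (indicator {0..1} \<alpha> *\<^sub>R (rGamma (2 - \<alpha>) * T powr (1 - \<alpha>)))"
    proof (cases "\<alpha> \<in> {0..<1}")
      case True
      have "((\<lambda>r. r powr (- \<alpha>)) has_integral (T powr (- \<alpha> + 1) / (- \<alpha> + 1))) {0..T}"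
        using True T by (intro has_integral_powr_from_0) auto
      then have "(\<integral>\<^sup>+r. ennreal (indicator {0..T} r * r powr (- \<alpha>)) \<partial>lborel) = ennreal (T powr (- \<alpha> + 1) / (- \<alpha> + 1))"
        by (intro nn_integral_has_integral_lebesgue) auto
      moreover have "h \<alpha> r = ennreal (rGamma (1 - \<alpha>)) * ennreal (indicator {0..T} r * r powr (- \<alpha>))" for r
        using True by (auto simp: h_def ennreal_mult rGamma_real_nonneg indicator_def)
      ultimately have "(\<integral>\<^sup>+r. h \<alpha> r \<partial>lborel) = ennreal (rGamma (1 - \<alpha>)) * ennreal (T powr (- \<alpha> + 1) / (- \<alpha> + 1))"
        by (simp add: nn_integral_cmult)
      also have "\<dots> = ennreal (rGamma (1 - \<alpha>) * (T powr (- \<alpha> + 1) / (- \<alpha> + 1)))"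
        using True by (intro ennreal_mult[symmetric] rGamma_real_nonneg) auto
      also have "rGamma (1 - \<alpha>) = (1 - \<alpha>) * rGamma (2 - \<alpha>)"
        using rGamma_plus1[of "1 - \<alpha>"] by simp
      finally show ?thesis using True by simp
    next
      case False
      then have "h \<alpha> r = 0" for r by (auto simp: h_def indicator_def)
      then show ?thesis by simp
    qed
  qed
  also have "\<dots> = ennreal (LINT \<alpha>:{0..1}|\<nu>. rGamma (2 - \<alpha>) * T powr (1 - \<alpha>))"
  proof -
    have "set_integrable \<nu> {0..1} (\<lambda>\<alpha>. rGamma (2 - \<alpha>) * T powr (1 - \<alpha>))"
      using T by (intro integrable_continuous continuous_intros) auto
    then show ?thesis
      unfolding set_lebesgue_integral_def set_integrable_def
      by (intro nn_integral_eq_integral AE_I2) (auto simp: indicator_def rGamma_real_nonneg)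
  qed
  finally show ?thesis .
qed

lemma frac_kernel_integrable: "set_integrable lborel {0..T} (frac_kernel \<nu>)"
proof -
  note [measurable] = measurable_frac_kernel
  have "integrable lborel (\<lambda>r. indicator {0..max 1 T} r *\<^sub>R frac_kernel \<nu> r)"
  proof (rule integrableI_nonneg)
    have "(\<integral>\<^sup>+r. ennreal (indicator {0..max 1 T} r *\<^sub>R frac_kernel \<nu> r) \<partial>lborel)
        = (\<integral>\<^sup>+r. indicator {0..max 1 T} r * ennreal (frac_kernel \<nu> r) \<partial>lborel)"
      by (intro nn_integral_cong) (simp add: indicator_def)
    also have "\<dots> < \<infinity>"
      using nn_integral_frac_kernel[of "max 1 T"] by (simp add: less_max_iff_disj order_le_less_trans)
    finally show "(\<integral>\<^sup>+r. ennreal (indicator {0..max 1 T} r *\<^sub>R frac_kernel \<nu> r) \<partial>lborel) < \<infinity>" .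
  qed (auto simp: frac_kernel_nonneg)
  then have "set_integrable lborel {0..max 1 T} (frac_kernel \<nu>)"
    by (simp add: set_integrable_def)
  then show ?thesis by (rule set_integrable_subset) auto
qed

sublocale kernel: memory_kernel "frac_kernel \<nu>"
proof
  fix r s :: real assume "0 < r" "r \<le> s"
  then show "frac_kernel \<nu> s \<le> frac_kernel \<nu> r"
    using frac_kernel_mono[of r s 1] by (simp add: powr_mono2')
qed (fact measurable_frac_kernel frac_kernel_nonneg frac_kernel_integrable)+

lemma integral_frac_kernel_le:
  assumes T: "0 < T"
  shows "(LINT r:{0..T}|lborel. frac_kernel \<nu> r) \<le> (LINT \<alpha>:{0..1}|\<nu>. rGamma (2 - \<alpha>) * T powr (1 - \<alpha>))"
proof -
  have "ennreal (LINT r:{0..T}|lborel. frac_kernel \<nu> r) = (\<integral>\<^sup>+r. ennreal (indicator {0..T} r *\<^sub>R frac_kernel \<nu> r) \<partial>lborel)"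
    unfolding set_lebesgue_integral_def
    using frac_kernel_integrable[of T] unfolding set_integrable_def
    by (intro nn_integral_eq_integral[symmetric]) (auto simp: frac_kernel_nonneg)
  also have "\<dots> = (\<integral>\<^sup>+r. indicator {0..T} r * ennreal (frac_kernel \<nu> r) \<partial>lborel)"
    by (intro nn_integral_cong) (simp add: indicator_def)
  also have "\<dots> \<le> ennreal (LINT \<alpha>:{0..1}|\<nu>. rGamma (2 - \<alpha>) * T powr (1 - \<alpha>))"
    by (rule nn_integral_frac_kernel[OF T])
  finally show ?thesis
    by (rule iffD1[OF ennreal_le_iff, rotated])
      (auto simp: set_lebesgue_integral_def indicator_def rGamma_real_nonneg
        intro!: Bochner_Integration.integral_nonneg)
qed

text \<open>\<open>rGamma (1 - \<alpha>)\<close> vanishes at \<open>\<alpha> = 1\<close> but has a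
  positive minimum \<open>c\<close> on \<open>[0, \<beta>]\<close>.\<close>

lemma frac_kernel_lower_bound:
  obtains c \<beta> where "0 < c" "0 < measure \<nu> {0..\<beta>}" "0 \<le> \<beta>" "\<beta> < 1"
    "\<forall>r>0. c * (LINT \<alpha>:{0..\<beta>}|\<nu>. r powr (- \<alpha>)) \<le> frac_kernel \<nu> r"
proof -
  obtain \<beta> where \<beta>: "\<beta> < 1" "0 < emeasure \<nu> {0..\<beta>}" using mass_below_one by blast
  have \<beta>0: "0 \<le> \<beta>" using \<beta>(2) by (cases "0 \<le> \<beta>") auto
  have "\<exists>x\<in>{0..\<beta>}. \<forall>y\<in>{0..\<beta>}. rGamma (1 - x) \<le> rGamma (1 - y)"
    using \<beta>0 by (intro continuous_attains_inf continuous_intros) auto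
  then obtain x where x: "x \<in> {0..\<beta>}" "\<And>y. y \<in> {0..\<beta>} \<Longrightarrow> rGamma (1 - x) \<le> rGamma (1 - y)" by blast
  define c where "c = rGamma (1 - x)"
  have "0 < c"
    using x(1) \<beta>(1) by (simp add: c_def rGamma_inverse_Gamma Gamma_real_pos)
  moreover have "0 < measure \<nu> {0..\<beta>}"
    using \<beta>(2) by (simp add: emeasure_eq_measure)
  moreover have "\<forall>r>0. c * (LINT \<alpha>:{0..\<beta>}|\<nu>. r powr (- \<alpha>)) \<le> frac_kernel \<nu> r"
  proof (intro allI impI)
    fix r :: real assume r: "0 < r"
    have "set_integrable \<nu> {0..1} (\<lambda>\<alpha>. c * r powr (- \<alpha>))"
      using r by (intro integrable_continuous continuous_intros) auto
    then have int: "set_integrable \<nu> {0..\<beta>} (\<lambda>\<alpha>. c * r powr (- \<alpha>))"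
      by (rule set_integrable_subset) (use \<beta> in auto)
    have "(LINT \<alpha>:{0..\<beta>}|\<nu>. c * r powr (- \<alpha>)) \<le> frac_kernel \<nu> r"
      unfolding frac_kernel_def set_lebesgue_integral_def
    proof (rule integral_mono)
      show "integrable \<nu> (\<lambda>\<alpha>. indicator {0..\<beta>} \<alpha> *\<^sub>R (c * r powr (- \<alpha>)))"
        using int by (simp add: set_integrable_def)
      show "integrable \<nu> (\<lambda>\<alpha>. indicator {0..1} \<alpha> *\<^sub>R (rGamma (1 - \<alpha>) * r powr (- \<alpha>)))"
        using integrable_density[OF r] by (simp add: set_integrable_def)
      fix \<alpha>
      show "indicator {0..\<beta>} \<alpha> *\<^sub>R (c * r powr (- \<alpha>)) \<le> indicator {0..1} \<alpha> *\<^sub>R (rGamma (1 - \<alpha>) * r powr (- \<alpha>))"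
        using x(2)[of \<alpha>] \<beta>(1) by (auto simp: indicator_def c_def rGamma_real_nonneg intro: mult_right_mono)
    qed
    then show "c * (LINT \<alpha>:{0..\<beta>}|\<nu>. r powr (- \<alpha>)) \<le> frac_kernel \<nu> r" by simp
  qed
  ultimately show thesis using \<beta>(1) \<beta>0 that by blast
qed

lemma frac_kernel_pos:
  assumes r: "0 < r"
  shows "0 < frac_kernel \<nu> r"
proof -
  obtain c \<beta> where c: "0 < c" "0 < measure \<nu> {0..\<beta>}" "0 \<le> \<beta>" "\<beta> < 1"
    and low: "\<forall>r>0. c * (LINT \<alpha>:{0..\<beta>}|\<nu>. r powr (- \<alpha>)) \<le> frac_kernel \<nu> r"
    by (rule frac_kernel_lower_bound)
  \<comment> \<open>A lower bound of \<open>r powr (- \<alpha>)\<close> for all orders in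
    \<open>[0, \<beta>]\<close>: the value at order 0 if \<open>r \<le> 1\<close>, at order 1
    otherwise.\<close>
  define m where "m = min 1 (1 / r)"
  have m: "0 < m" using r by (simp add: m_def)
  have "m \<le> r powr (- \<alpha>)" if "\<alpha> \<in> {0..\<beta>}" for \<alpha>
  proof (cases "r \<le> 1")
    case True
    then have "1 powr (- \<alpha>) \<le> r powr (- \<alpha>)"
      using that r by (intro powr_mono2') auto
    then show ?thesis by (simp add: m_def)
  next
    case False
    then have "r powr - 1 \<le> r powr (- \<alpha>)"
      using that c by (intro powr_mono) auto
    then show ?thesis using r by (simp add: m_def powr_minus_divide)
  qed
  moreover have "set_integrable \<nu> {0..1} (\<lambda>\<alpha>. r powr (- \<alpha>))"
    using r by (intro integrable_continuous continuous_intros) auto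
  then have "set_integrable \<nu> {0..\<beta>} (\<lambda>\<alpha>. r powr (- \<alpha>))"
    by (rule set_integrable_subset) (use c in auto)
  moreover have "set_integrable \<nu> {0..\<beta>} (\<lambda>\<alpha>. m)"
    by (simp add: set_integrable_def emeasure_eq_measure)
  ultimately have "(LINT \<alpha>:{0..\<beta>}|\<nu>. m) \<le> (LINT \<alpha>:{0..\<beta>}|\<nu>. r powr (- \<alpha>))"
    by (intro set_integral_mono)
  moreover have "(LINT \<alpha>:{0..\<beta>}|\<nu>. m) = measure \<nu> {0..\<beta>} * m"
    by (simp add: set_lebesgue_integral_def)
  moreover have "0 < measure \<nu> {0..\<beta>} * m" using m c by simp
  ultimately have "0 < c * (LINT \<alpha>:{0..\<beta>}|\<nu>. r powr (- \<alpha>))" using c(1) by simp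
  then show ?thesis using low r by fastforce
qed

text \<open>Dominated convergence with majorant \<open>rGamma (1 - \<alpha>)\<close> for
  \<open>r \<ge> 1\<close>; pointwise decay fails only at order 0, a null set by
  \<open>null_zero\<close>.\<close>

lemma frac_kernel_tendsto_0: "(frac_kernel \<nu> \<longlongrightarrow> 0) at_top"
proof -
  have "((\<lambda>r. LINT \<alpha>|\<nu>. indicator {0..1} \<alpha> *\<^sub>R (rGamma (1 - \<alpha>) * r powr (- \<alpha>))) \<longlongrightarrow> (LINT \<alpha>|\<nu>. 0)) at_top"
  proof (rule integral_dominated_convergence_at_top)
    have [measurable]: "(rGamma :: real \<Rightarrow> real) \<in> borel_measurable borel"
      by (intro borel_measurable_continuous_onI continuous_intros)
    show "(\<lambda>\<alpha>. indicator {0..1} \<alpha> *\<^sub>R (rGamma (1 - \<alpha>) * r powr (- \<alpha>))) \<in> borel_measurable \<nu>" for r :: real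
      by measurable
    show "integrable \<nu> (\<lambda>\<alpha>. indicator {0..1} \<alpha> *\<^sub>R rGamma (1 - \<alpha>))"
      using integrable_continuous[of "\<lambda>\<alpha>. rGamma (1 - \<alpha>)"]
      by (simp add: set_integrable_def continuous_intros)
    have "AE \<alpha> in \<nu>. \<alpha> \<noteq> 0"
      using null_zero by (intro AE_I[of _ _ "{0}"]) auto
    then show "AE \<alpha> in \<nu>. ((\<lambda>r. indicator {0..1} \<alpha> *\<^sub>R (rGamma (1 - \<alpha>) * r powr (- \<alpha>))) \<longlongrightarrow> 0) at_top"
    proof eventually_elim
      case (elim \<alpha>)
      show ?case
      proof (cases "\<alpha> \<in> {0..1}")
        case True
        then have "((\<lambda>r. r powr (- \<alpha>)) \<longlongrightarrow> 0) at_top"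
          using elim by (intro tendsto_neg_powr filterlim_ident) auto
        then show ?thesis using True by (simp add: tendsto_mult_right_zero)
      qed simp
    qed
    have "indicator {0..1} \<alpha> *\<^sub>R (rGamma (1 - \<alpha>) * r powr (- \<alpha>)) \<le> indicator {0..1} \<alpha> *\<^sub>R rGamma (1 - \<alpha>)"
      if "1 \<le> r" for \<alpha> r :: real
    proof (cases "\<alpha> \<in> {0..1}")
      case True
      then have "r powr (- \<alpha>) \<le> 1 powr (- \<alpha>)" using that by (intro powr_mono2') auto
      then show ?thesis
        using True mult_left_le[of "r powr (- \<alpha>)" "rGamma (1 - \<alpha>)"] by (simp add: rGamma_real_nonneg)
    qed simp
    then show "\<forall>\<^sub>F r in at_top. AE \<alpha> in \<nu>. norm (indicator {0..1} \<alpha> *\<^sub>R (rGamma (1 - \<alpha>) * r powr (- \<alpha>)))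
        \<le> indicator {0..1} \<alpha> *\<^sub>R rGamma (1 - \<alpha>)"
      by (intro eventually_at_top_linorderI[of 1] AE_I2) (auto simp: indicator_def rGamma_real_nonneg)
  qed simp
  then show ?thesis
    by (simp add: frac_kernel_def[abs_def] set_lebesgue_integral_def)
qed

text \<open>For \<open>T \<ge> 1\<close> orders above \<open>\<beta>\<close> contribute at most
  \<open>N * T powr (- \<beta>)\<close>, and \<open>T powr (- \<beta>)\<close> is at most the mean
  \<open>J / m\<close> of \<open>T powr (- \<alpha>)\<close> over \<open>[0, \<beta>]\<close>. Thus
  low orders control the whole integral, and they bound the kernel from below.\<close>

lemma frac_kernel_average:
  obtains C where "\<forall>T\<ge>1. (LINT r:{0..T}|lborel. frac_kernel \<nu> r) \<le> C * T * frac_kernel \<nu> T"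
proof -
  obtain c \<beta> where c: "0 < c" "0 < measure \<nu> {0..\<beta>}" "0 \<le> \<beta>" "\<beta> < 1"
    and low: "\<forall>r>0. c * (LINT \<alpha>:{0..\<beta>}|\<nu>. r powr (- \<alpha>)) \<le> frac_kernel \<nu> r"
    by (rule frac_kernel_lower_bound)
  have "\<exists>x\<in>{0..1}. \<forall>y\<in>{0..1::real}. rGamma (2 - y) \<le> rGamma (2 - x)"
    by (intro continuous_attains_sup continuous_intros) auto
  then obtain x where x: "x \<in> {0..1}" "\<And>y. y \<in> {0..1} \<Longrightarrow> rGamma (2 - y) \<le> rGamma (2 - x :: real)" by blast
  define G where "G = rGamma (2 - x)"
  have G: "0 \<le> G" using x(1) by (simp add: G_def rGamma_real_nonneg)
  define m where "m = measure \<nu> {0..\<beta>}"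
  define N where "N = measure \<nu> {0..1}"
  have "(LINT r:{0..T}|lborel. frac_kernel \<nu> r) \<le> (G * (1 + N / m) / c) * T * frac_kernel \<nu> T"
    if T: "1 \<le> T" for T
  proof -
    define J where "J = (LINT \<alpha>:{0..\<beta>}|\<nu>. T powr (- \<alpha>))"
    have powr_int: "set_integrable \<nu> {0..1} (\<lambda>\<alpha>. T powr (- \<alpha>))"
      using T by (intro integrable_continuous continuous_intros) auto
    have powr_int': "set_integrable \<nu> {0..\<beta>} (\<lambda>\<alpha>. T powr (- \<alpha>))"
      using powr_int by (rule set_integrable_subset) (use c in auto)
    have const_int: "set_integrable \<nu> {0..b} (\<lambda>\<alpha>. d)" for b d :: real
      by (simp add: set_integrable_def emeasure_eq_measure)
    have const: "(LINT \<alpha>:{0..b}|\<nu>. d) = measure \<nu> {0..b} * d" for b d :: real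
      by (simp add: set_lebesgue_integral_def)
    have "measure \<nu> {0..\<beta>} * T powr (- \<beta>) \<le> J"
      unfolding J_def const[symmetric]
      using T by (intro set_integral_mono const_int powr_int' powr_mono) auto
    then have J: "T powr (- \<beta>) \<le> J / m"
      using c(2) by (simp add: m_def field_simps)
    have "(LINT r:{0..T}|lborel. frac_kernel \<nu> r) \<le> (LINT \<alpha>:{0..1}|\<nu>. rGamma (2 - \<alpha>) * T powr (1 - \<alpha>))"
      using T by (intro integral_frac_kernel_le) auto
    also have "\<dots> \<le> (LINT \<alpha>:{0..1}|\<nu>. (G * T) * T powr (- \<alpha>))"
    proof (rule set_integral_mono)
      show "set_integrable \<nu> {0..1} (\<lambda>\<alpha>. rGamma (2 - \<alpha>) * T powr (1 - \<alpha>))"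
        using T by (intro integrable_continuous continuous_intros) auto
      show "set_integrable \<nu> {0..1} (\<lambda>\<alpha>. (G * T) * T powr (- \<alpha>))"
        using powr_int by simp
      fix \<alpha> :: real assume "\<alpha> \<in> {0..1}"
      then have "rGamma (2 - \<alpha>) * T powr (1 - \<alpha>) \<le> G * T powr (1 - \<alpha>)"
        unfolding G_def using x(2) by (intro mult_right_mono) auto
      also have "G * T powr (1 - \<alpha>) = G * (T * T powr (- \<alpha>))"
        using T by (simp add: powr_diff powr_minus_divide)
      finally show "rGamma (2 - \<alpha>) * T powr (1 - \<alpha>) \<le> (G * T) * T powr (- \<alpha>)" by (simp add: mult_ac)
    qed
    also have "\<dots> = (G * T) * (LINT \<alpha>:{0..1}|\<nu>. T powr (- \<alpha>))" by simp
    also have "\<dots> \<le> (G * T) * (J + N * T powr (- \<beta>))"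
    proof (rule mult_left_mono)
      have "(LINT \<alpha>:{0..1}|\<nu>. T powr (- \<alpha>))
          \<le> (LINT \<alpha>|\<nu>. indicator {0..\<beta>} \<alpha> *\<^sub>R T powr (- \<alpha>) + indicator {0..1} \<alpha> *\<^sub>R T powr (- \<beta>))"
        unfolding set_lebesgue_integral_def
      proof (rule integral_mono)
        fix \<alpha> :: real
        have "T powr (- \<alpha>) \<le> T powr (- \<beta>)" if "\<beta> < \<alpha>"
          using that T by (intro powr_mono) auto
        then show "indicator {0..1} \<alpha> *\<^sub>R T powr (- \<alpha>)
            \<le> indicator {0..\<beta>} \<alpha> *\<^sub>R T powr (- \<alpha>) + indicator {0..1} \<alpha> *\<^sub>R T powr (- \<beta>)"
          by (auto simp: indicator_def)
      qed (use powr_int powr_int' const_int[of 1 "T powr (- \<beta>)"] in \<open>auto simp: set_integrable_def\<close>)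
      also have "\<dots> = J + N * T powr (- \<beta>)"
        using powr_int' const_int[of 1 "T powr (- \<beta>)"] const[of 1 "T powr (- \<beta>)"]
        by (simp add: set_integrable_def set_lebesgue_integral_def J_def N_def)
      finally show "(LINT \<alpha>:{0..1}|\<nu>. T powr (- \<alpha>)) \<le> J + N * T powr (- \<beta>)" .
    qed (use G T in auto)
    also have "\<dots> \<le> (G * T) * (J + N * (J / m))"
      using G T J by (intro mult_left_mono add_left_mono) (auto simp: N_def)
    also have "\<dots> = (G * T * (1 + N / m) / c) * (c * J)"
      using c(1) by (simp add: field_simps)
    also have "\<dots> \<le> (G * T * (1 + N / m) / c) * frac_kernel \<nu> T"
      using G T c low[rule_format, of T] by (intro mult_left_mono) (auto simp: J_def N_def m_def)
    finally show ?thesis by (simp add: mult_ac)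
  qed
  then have "\<forall>T\<ge>1. (LINT r:{0..T}|lborel. frac_kernel \<nu> r) \<le> (G * (1 + N / m) / c) * T * frac_kernel \<nu> T"
    by blast
  then show thesis by (rule that)
qed

lemma regular_frac_kernel: "\<exists>C. regular_kernel (frac_kernel \<nu>) C"
proof -
  obtain C where C: "\<forall>T\<ge>1. (LINT r:{0..T}|lborel. frac_kernel \<nu> r) \<le> C * T * frac_kernel \<nu> T"
    by (rule frac_kernel_average)
  have "regular_kernel (frac_kernel \<nu>) C"
  proof
    fix q r :: real assume q: "1 \<le> q" and r: "0 < r"
    show "frac_kernel \<nu> (r / q) \<le> q * frac_kernel \<nu> r"
    proof (rule frac_kernel_mono)
      fix \<alpha> :: real assume \<alpha>: "\<alpha> \<in> {0..1}"
      have "q powr \<alpha> \<le> q powr 1"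
        using q \<alpha> by (intro powr_mono) auto
      moreover have "(r / q) powr (- \<alpha>) = q powr \<alpha> * r powr (- \<alpha>)"
        using q r by (simp add: powr_divide powr_minus field_simps)
      ultimately show "(r / q) powr (- \<alpha>) \<le> q * r powr (- \<alpha>)"
        using q by (simp add: mult_right_mono)
    qed (use q r in auto)
  qed (use C frac_kernel_pos frac_kernel_tendsto_0 in auto)
  then show ?thesis ..
qed

text \<open>Exchange of the integrals over orders and over time. The density is nonnegative, so
  integrating norms over the orders yields the norm of the convolution integrand, which
  \<open>convolution_integrable\<close> covers. At \<open>\<alpha> = 1\<close> both
  \<open>1 / Gamma (1 - \<alpha>)\<close> and \<open>rGamma (1 - \<alpha>)\<close> are 0.\<close>

lemma fractional_op_eq_convolution:
  fixes U :: "real \<Rightarrow> 'a::euclidean_space"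
  assumes t: "0 \<le> a" "a < t" and U': "set_integrable lborel {0..t} (\<lambda>s. vector_derivative U (at s))"
    and B: "\<And>s. s \<in> {a..t} \<Longrightarrow> norm (vector_derivative U (at s)) \<le> B"
  shows "fractional_op \<nu> U t = (LINT s:{0..t}|lborel. frac_kernel \<nu> (t - s) *\<^sub>R vector_derivative U (at s))"
proof -
  interpret pair_sigma_finite lborel \<nu> ..
  have [measurable]: "(rGamma :: real \<Rightarrow> real) \<in> borel_measurable borel"
    by (intro borel_measurable_continuous_onI continuous_intros)
  define D where "D s = indicator {0..t} s *\<^sub>R vector_derivative U (at s)" for s
  have [measurable]: "D \<in> borel_measurable borel"
    using U' unfolding set_integrable_def D_def[abs_def] by (auto dest: borel_measurable_integrable)
  define h where "h s \<alpha> = (indicator {0..1} \<alpha> * (rGamma (1 - \<alpha>) * (t - s) powr (- \<alpha>))) *\<^sub>R D s" for s \<alpha>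
  have h_meas: "case_prod h \<in> borel_measurable (lborel \<Otimes>\<^sub>M \<nu>)"
    unfolding h_def by measurable
  \<comment> \<open>At \<open>s = t\<close> the density is zero because
    \<open>0 powr x = 0\<close>.\<close>
  have dens: "integrable \<nu> (\<lambda>\<alpha>. indicator {0..1} \<alpha> * (rGamma (1 - \<alpha>) * (t - s) powr (- \<alpha>)))" if "s \<le> t" for s
  proof (cases "s = t")
    case False
    then show ?thesis
      using integrable_density[of "t - s"] that by (simp add: set_integrable_def)
  qed simp
  have inner: "(LINT \<alpha>|\<nu>. h s \<alpha>) = indicator {0..t} s *\<^sub>R (frac_kernel \<nu> (t - s) *\<^sub>R vector_derivative U (at s))" for s
  proof (cases "s \<in> {0..t}")
    case True
    then show ?thesis
      using dens[of s] by (simp add: h_def frac_kernel_def set_lebesgue_integral_def D_def)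
  qed (simp add: h_def D_def)
  have "integrable (lborel \<Otimes>\<^sub>M \<nu>) (case_prod h)"
  proof (rule Fubini_integrable[OF h_meas])
    have norm_eq: "(LINT \<alpha>|\<nu>. norm (case_prod h (s, \<alpha>))) = norm (indicator {0..t} s *\<^sub>R (frac_kernel \<nu> (t - s) *\<^sub>R vector_derivative U (at s)))" for s
    proof (cases "s \<in> {0..t}")
      case True
      have "norm (h s \<alpha>) = (indicator {0..1} \<alpha> * (rGamma (1 - \<alpha>) * (t - s) powr (- \<alpha>))) * norm (D s)" for \<alpha>
        by (auto simp: h_def indicator_def rGamma_real_nonneg)
      then show ?thesis
        using True dens[of s] frac_kernel_nonneg[of "t - s"]
        by (simp add: frac_kernel_def set_lebesgue_integral_def D_def)
    qed (simp add: h_def D_def)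
    show "integrable lborel (\<lambda>s. LINT \<alpha>|\<nu>. norm (case_prod h (s, \<alpha>)))"
      unfolding norm_eq
      by (rule integrable_norm[OF kernel.convolution_integrable[OF t U' B, unfolded set_integrable_def]])
    have "integrable \<nu> (h s)" for s
    proof (cases "s \<in> {0..t}")
      case True
      then show ?thesis unfolding h_def using dens[of s] by (intro integrable_scaleR_left) auto
    next
      case False
      then have "h s = (\<lambda>\<alpha>. 0)" by (auto simp: h_def D_def)
      then show ?thesis by simp
    qed
    then show "AE s in lborel. integrable \<nu> (\<lambda>\<alpha>. case_prod h (s, \<alpha>))" by simp
  qed
  from Fubini_integral[OF this] have "(LINT \<alpha>|\<nu>. LINT s|lborel. h s \<alpha>) = (LINT s|lborel. LINT \<alpha>|\<nu>. h s \<alpha>)" .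
  moreover have "(LINT s|lborel. h s \<alpha>) = indicator {0..1} \<alpha> *\<^sub>R caputo \<alpha> U t" for \<alpha>
  proof -
    have "h s \<alpha> = (indicator {0..1} \<alpha> * rGamma (1 - \<alpha>)) *\<^sub>R
        (indicator {0..t} s *\<^sub>R ((t - s) powr (- \<alpha>) *\<^sub>R vector_derivative U (at s)))" for s
      by (simp add: h_def D_def mult_ac)
    then have "(LINT s|lborel. h s \<alpha>) = (indicator {0..1} \<alpha> * rGamma (1 - \<alpha>)) *\<^sub>R
        (LINT s|lborel. indicator {0..t} s *\<^sub>R ((t - s) powr (- \<alpha>) *\<^sub>R vector_derivative U (at s)))"
      by (simp only: integral_scaleR_right)
    then show ?thesis
      by (simp add: caputo_def set_lebesgue_integral_def rGamma_inverse_Gamma divide_inverse)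
  qed
  ultimately show ?thesis
    by (simp add: inner fractional_op_def set_lebesgue_integral_def)
qed

end


section \<open>Long-time behaviour of the solution matrix\<close>

text \<open>All orders are positive because the last is the smallest; the witness
  \<open>\<beta> = \<alpha> 1 < 1\<close> works because the weight there is
  \<open>b 1 = 1\<close>.\<close>

lemma order_measure_multi_term:
  assumes "multi_term \<nu>"
  shows "order_measure \<nu>"
proof -
  obtain m b \<alpha> where m: "1 \<le> m" "0 < \<alpha> m" "strict_antimono_on {1..m} \<alpha>" "\<alpha> 1 < 1"
      "b 1 = (1::real)" and \<nu>: "\<nu> = multi_term_measure m b \<alpha>"
    using assms unfolding multi_term_def by blast
  let ?M = "point_measure {1..m} (\<lambda>i. ennreal (b i))"
  have meas: "\<alpha> \<in> measurable ?M borel" by (simp add: point_measure_def)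
  have em: "emeasure \<nu> X = (\<Sum>i\<in>\<alpha> -` X \<inter> {1..m}. ennreal (b i))" if "X \<in> sets borel" for X
    unfolding \<nu> multi_term_measure_def emeasure_distr[OF meas that]
    by (subst emeasure_point_measure_finite) (auto simp: space_point_measure)
  have pos: "0 < \<alpha> i" if "i \<in> {1..m}" for i
  proof (cases "i = m")
    case False
    then have "\<alpha> m < \<alpha> i"
      using m(1,3) that by (auto simp: monotone_on_def)
    then show ?thesis using m(2) by simp
  qed (use m in simp)
  show ?thesis
  proof (rule order_measure.intro, rule finite_measureI)
    show "emeasure \<nu> (space \<nu>) \<noteq> \<infinity>"
      using em[of UNIV] by (simp add: \<nu> multi_term_measure_def)
    show "order_measure_axioms \<nu>"
    proof
      show "sets \<nu> = sets borel" by (simp add: \<nu> multi_term_measure_def)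
      have "\<alpha> -` {0} \<inter> {1..m} = {}" using pos by force
      then show "emeasure \<nu> {0} = 0" using em[of "{0}"] by simp
      have "ennreal (b 1) \<le> (\<Sum>i\<in>\<alpha> -` {0..\<alpha> 1} \<inter> {1..m}. ennreal (b i))"
        using m(1) pos[of 1] by (intro member_le_sum) auto
      then have "0 < emeasure \<nu> {0..\<alpha> 1}"
        using em[of "{0..\<alpha> 1}"] m(5) by (simp add: order_less_le_trans[OF zero_less_one])
      then show "\<exists>\<beta><1. 0 < emeasure \<nu> {0..\<beta>}" using m(4) by blast
    qed
  qed
qed

lemma hoelder_continuous_imp_continuous_on:
  assumes "hoelder_continuous_on A f"
  shows "continuous_on A f"
proof -
  obtain \<gamma> C where \<gamma>: "0 < \<gamma>" and C: "\<And>x y. x \<in> A \<Longrightarrow> y \<in> A \<Longrightarrow> \<bar>f x - f y\<bar> \<le> C * \<bar>x - y\<bar> powr \<gamma>"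
    using assms unfolding hoelder_continuous_on_def by blast
  show ?thesis
    unfolding continuous_on_def
  proof
    fix x assume x: "x \<in> A"
    have "((\<lambda>y. C * \<bar>y - x\<bar> powr \<gamma>) \<longlongrightarrow> C * \<bar>x - x\<bar> powr \<gamma>) (at x within A)"
      using \<gamma> by (intro tendsto_intros) auto
    then have "((\<lambda>y. C * \<bar>y - x\<bar> powr \<gamma>) \<longlongrightarrow> 0) (at x within A)" using \<gamma> by simp
    moreover have "\<forall>\<^sub>F y in at x within A. norm (f y - f x) \<le> C * \<bar>y - x\<bar> powr \<gamma>"
      using C x by (auto simp: eventually_at_filter)
    ultimately have "((\<lambda>y. f y - f x) \<longlongrightarrow> 0) (at x within A)"
      by (rule Lim_null_comparison[rotated])
    then show "(f \<longlongrightarrow> f x) (at x within A)" by (rule LIM_zero_cancel)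
  qed
qed

text \<open>Having a Lebesgue density, the measure does not charge order 0; it charges
  \<open>[0, 1/2]\<close> because the density is continuous and positive at 0.\<close>

lemma order_measure_distributed_order:
  assumes "distributed_order \<nu>"
  shows "order_measure \<nu>"
proof -
  obtain \<mu> where \<mu>: "\<And>\<alpha>. \<alpha> \<in> {0..1} \<Longrightarrow> 0 \<le> \<mu> \<alpha>" "hoelder_continuous_on {0..1} \<mu>" "0 < \<mu> 0 * \<mu> 1"
    and \<nu>: "\<nu> = distributed_order_measure \<mu>"
    using assms unfolding distributed_order_def by blast
  have cont: "continuous_on {0..1} \<mu>"
    using \<mu>(2) by (rule hoelder_continuous_imp_continuous_on)
  have [measurable]: "(\<lambda>\<alpha>. indicator {0..1} \<alpha> * \<mu> \<alpha>) \<in> borel_measurable borel"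
    using borel_measurable_continuous_on_indicator[OF _ cont] by simp
  have em: "emeasure \<nu> X = (\<integral>\<^sup>+\<alpha>. ennreal (indicator {0..1} \<alpha> * \<mu> \<alpha>) * indicator X \<alpha> \<partial>lborel)"
    if "X \<in> sets borel" for X
    unfolding \<nu> distributed_order_measure_def using that by (subst emeasure_density) auto
  have "0 < \<mu> 0" using \<mu>(1)[of 0] \<mu>(3) by (cases "\<mu> 0 = 0") auto
  show ?thesis
  proof (rule order_measure.intro, rule finite_measureI)
    have "integrable lborel (\<lambda>\<alpha>. indicator {0..1} \<alpha> *\<^sub>R \<mu> \<alpha>)"
      using borel_integrable_atLeastAtMost'[OF cont] by (simp add: set_integrable_def)
    then have "(\<integral>\<^sup>+\<alpha>. ennreal (norm (indicator {0..1} \<alpha> *\<^sub>R \<mu> \<alpha>)) \<partial>lborel) < \<infinity>"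
      by (simp add: integrable_iff_bounded)
    also have "(\<integral>\<^sup>+\<alpha>. ennreal (norm (indicator {0..1} \<alpha> *\<^sub>R \<mu> \<alpha>)) \<partial>lborel) = emeasure \<nu> UNIV"
      using em[of UNIV] \<mu>(1) by (auto simp: indicator_def intro!: nn_integral_cong)
    finally show "emeasure \<nu> (space \<nu>) \<noteq> \<infinity>"
      by (simp add: \<nu> distributed_order_measure_def)
    show "order_measure_axioms \<nu>"
    proof
      show "sets \<nu> = sets borel" by (simp add: \<nu> distributed_order_measure_def)
      show "emeasure \<nu> {0} = 0"
        using em[of "{0}"] by (simp add: nn_integral_null_set)
      have "(\<mu> \<longlongrightarrow> \<mu> 0) (at 0 within {0..1})"
        using cont unfolding continuous_on_def by (rule bspec) simp
      then have "\<forall>\<^sub>F \<alpha> in at_right 0. \<mu> 0 / 2 < \<mu> \<alpha>"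
        using \<open>0 < \<mu> 0\<close> by (intro order_tendstoD(1)) (auto simp: at_within_Icc_at_right)
      then obtain d where d: "0 < d" "\<And>\<alpha>. 0 < \<alpha> \<Longrightarrow> \<alpha> < d \<Longrightarrow> \<mu> 0 / 2 < \<mu> \<alpha>"
        unfolding eventually_at_right_field by blast
      \<comment> \<open>Small enough for \<open>[0, e]\<close> to lie in \<open>[0, 1/2]\<close> and
        in the range where the density exceeds half its value at 0.\<close>
      define e where "e = min (d / 2) (1 / 2)"
      have e: "0 < e" "e \<le> 1 / 2" "e < d" using d(1) by (auto simp: e_def)
      have "0 < ennreal (\<mu> 0 / 2) * ennreal e"
        using e \<open>0 < \<mu> 0\<close> by (simp add: ennreal_mult[symmetric])
      also have "\<dots> = (\<integral>\<^sup>+\<alpha>. ennreal (\<mu> 0 / 2) * indicator {0..e} \<alpha> \<partial>lborel)"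
        using e by (simp add: nn_integral_cmult_indicator)
      also have "\<dots> \<le> (\<integral>\<^sup>+\<alpha>. ennreal (indicator {0..1} \<alpha> * \<mu> \<alpha>) * indicator {0..1/2} \<alpha> \<partial>lborel)"
      proof (rule nn_integral_mono)
        fix \<alpha> :: real
        have "\<mu> 0 / 2 \<le> \<mu> \<alpha>" if "\<alpha> \<in> {0..e}"
          using that d(2)[of \<alpha>] e \<open>0 < \<mu> 0\<close> by (cases "\<alpha> = 0") auto
        then show "ennreal (\<mu> 0 / 2) * indicator {0..e} \<alpha>
            \<le> ennreal (indicator {0..1} \<alpha> * \<mu> \<alpha>) * indicator {0..1/2} \<alpha>"
          using e by (auto simp: indicator_def intro: ennreal_leI)
      qed
      also have "\<dots> = emeasure \<nu> {0..1/2}" by (rule em[symmetric]) simp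
      finally show "\<exists>\<beta><1. 0 < emeasure \<nu> {0..\<beta>}" by (intro exI[of _ "1/2"]) simp
    qed
  qed
qed

text \<open>Here \<open>w\<close> is a left eigenvector of \<open>H\<close>, expressed through its
  pairing; the pairing commutes with the convolution and turns \<open>H\<close> into the scalar
  \<open>l\<close>.\<close>

lemma (in order_measure) relaxation_left_eigenvector:
  fixes H :: "real^'n^'n"
  assumes sol: "is_solution \<nu> H V U" and l: "0 < l" and w: "\<And>x. w \<bullet> (H *v x) = l * (w \<bullet> x)"
  shows "relaxation (frac_kernel \<nu>) l (\<lambda>t. w \<bullet> U t) (\<lambda>t. w \<bullet> vector_derivative U (at t))"
proof (intro relaxation.intro kernel.memory_kernel_axioms relaxation_axioms.intro)
  define D where "D = (\<lambda>s. vector_derivative U (at s))"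
  \<comment> \<open>\<open>C1_differentiable_on\<close> supplies some continuous derivative; it
    agrees with \<open>vector_derivative\<close> at positive times, which transfers
    continuity.\<close>
  obtain D' where D': "\<And>t. 0 < t \<Longrightarrow> (U has_vector_derivative D' t) (at t)" "continuous_on {0<..} D'"
    using sol unfolding is_solution_def C1_differentiable_on_def by auto
  have DD': "D t = D' t" if "0 < t" for t
    unfolding D_def using D'(1)[OF that] by (rule vector_derivative_at)
  have D: "(U has_vector_derivative D t) (at t)" if "0 < t" for t
    using D'(1)[OF that] DD'[OF that] by simp
  have D_cont: "continuous_on {0<..} D"
    by (rule continuous_on_eq[OF D'(2)]) (simp add: DD')
  have D_int: "set_integrable lborel {0..t} D" if "0 < t" for t
    using sol that by (simp add: is_solution_def D_def)
  show "0 < l" by fact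
  show "continuous_on {0..} (\<lambda>t. w \<bullet> U t)"
    using sol by (auto simp: is_solution_def intro: continuous_intros)
  show "continuous_on {0<..} (\<lambda>t. w \<bullet> vector_derivative U (at t))"
    using D_cont unfolding D_def by (intro continuous_intros)
  fix t :: real assume t: "0 < t"
  show "((\<lambda>t. w \<bullet> U t) has_real_derivative w \<bullet> vector_derivative U (at t)) (at t)"
    using bounded_linear.has_vector_derivative[OF bounded_linear_inner_right D[OF t], of w]
    by (simp add: has_real_derivative_iff_has_vector_derivative D_def)
  show "set_integrable lborel {0..t} (\<lambda>s. w \<bullet> vector_derivative U (at s))"
    using integrable_inner_right[of w lborel, OF D_int[OF t, unfolded set_integrable_def]]
    by (simp add: set_integrable_def D_def)
  have "compact (D ` {t / 2..t})"
    by (rule compact_continuous_image[OF continuous_on_subset[OF D_cont]]) (use t in auto)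
  from compact_imp_bounded[OF this, unfolded bounded_iff]
  obtain B where "\<forall>y\<in>D ` {t / 2..t}. norm y \<le> B" ..
  then have B: "\<And>s. s \<in> {t / 2..t} \<Longrightarrow> norm (D s) \<le> B" by simp
  have t': "0 \<le> t / 2" "t / 2 < t" using t by auto
  have conv: "fractional_op \<nu> U t = (LINT s:{0..t}|lborel. frac_kernel \<nu> (t - s) *\<^sub>R D s)"
    unfolding D_def
    by (rule fractional_op_eq_convolution[OF t' D_int[OF t, unfolded D_def] B[unfolded D_def]])
  have int: "set_integrable lborel {0..t} (\<lambda>s. frac_kernel \<nu> (t - s) *\<^sub>R D s)"
    by (rule kernel.convolution_integrable[OF t' D_int[OF t] B])
  have "(LINT s:{0..t}|lborel. frac_kernel \<nu> (t - s) * (w \<bullet> D s)) = w \<bullet> fractional_op \<nu> U t"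
    using integral_inner_right[of w lborel, OF int[unfolded set_integrable_def]]
    by (simp add: conv set_lebesgue_integral_def mult_ac)
  also have "fractional_op \<nu> U t = - (H *v U t)"
    using sol t unfolding is_solution_def by (simp add: eq_neg_iff_add_eq_0)
  finally show "(LINT s:{0..t}|lborel. frac_kernel \<nu> (t - s) * (w \<bullet> vector_derivative U (at s)))
      = - l * (w \<bullet> U t)"
    by (simp add: D_def w)
qed

text \<open>Since \<open>M ** H = S\<close>, an eigenvector \<open>e\<close> of the pencil yields
  the left eigenvector \<open>M *v e\<close> of \<open>H\<close>. The limit is proved for these
  pairings, and linearity extends it to all \<open>v\<close> because the eigenvectors span.\<close>

lemma solution_matrix_asymptotics:
  fixes M S :: "real^'n^'n" and E :: "real \<Rightarrow> real^'n^'n"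
  assumes \<nu>: "order_measure \<nu>"
    and sym: "transpose M = M" "transpose S = S"
    and pos: "\<And>x. x \<noteq> 0 \<Longrightarrow> 0 < x \<bullet> (M *v x)" "\<And>x. x \<noteq> 0 \<Longrightarrow> 0 < x \<bullet> (S *v x)"
    and H: "H = matrix_inv M ** S" and E: "is_solution_matrix \<nu> H E"
  shows "((\<lambda>t. E t $ i $ j / frac_kernel \<nu> t) \<longlongrightarrow> matrix_inv H $ i $ j) at_top"
proof -
  interpret order_measure \<nu> by (rule \<nu>)
  obtain C where "regular_kernel (frac_kernel \<nu>) C" using regular_frac_kernel by blast
  then interpret reg: regular_kernel "frac_kernel \<nu>" C .
  have M: "invertible M" and S: "invertible S"
    by (rule posdef_matrix_invertible, fact pos)+
  have M_inv: "M ** matrix_inv M = mat 1" "matrix_inv M ** M = mat 1"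
    using matrix_inv_invertible[OF M] by auto
  then have "invertible (matrix_inv M)" unfolding invertible_def by blast
  then have "invertible H" unfolding H using S by (rule invertible_mult)
  then have H_inv: "H ** matrix_inv H = mat 1" by (rule matrix_inv_invertible)
  define V where "V = (axis j 1 :: real^'n)"
  have limit: "((\<lambda>t. ((M *v v) \<bullet> (E t *v V)) / frac_kernel \<nu> t) \<longlongrightarrow> (M *v v) \<bullet> (matrix_inv H *v V)) at_top"
    (is "?lim v") for v
  proof -
    have "v \<in> span {v. \<exists>l>0. S *v v = l *\<^sub>R (M *v v)}"
      using generalized_eigenvectors_span[OF sym pos] by simp
    then show ?thesis
    proof (induction rule: span_induct_alt)
      case (step c e v)
      then obtain l where l: "0 < l" "S *v e = l *\<^sub>R (M *v e)" by blast
      have eig: "(M *v e) \<bullet> (H *v x) = l * ((M *v e) \<bullet> x)" for x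
      proof -
        have "(M *v e) \<bullet> (H *v x) = e \<bullet> (M *v (H *v x))"
          using dot_symmetric_matrix[OF sym(1), of "H *v x" e] by (simp add: inner_commute)
        also have "M *v (H *v x) = S *v x"
          by (simp add: H matrix_vector_mul_assoc matrix_mul_assoc M_inv)
        also have "e \<bullet> (S *v x) = l * ((M *v e) \<bullet> x)"
          using dot_symmetric_matrix[OF sym(2), of e x] l(2) by (simp add: inner_commute)
        finally show ?thesis .
      qed
      have sol: "is_solution \<nu> H V (\<lambda>t. E t *v V)"
        using E by (simp add: is_solution_matrix_def)
      interpret relaxation "frac_kernel \<nu>" l "\<lambda>t. (M *v e) \<bullet> (E t *v V)"
          "\<lambda>s. (M *v e) \<bullet> vector_derivative (\<lambda>t. E t *v V) (at s)"
        by (rule relaxation_left_eigenvector[OF sol l(1) eig])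
      interpret regular_relaxation "frac_kernel \<nu>" C l "\<lambda>t. (M *v e) \<bullet> (E t *v V)"
          "\<lambda>s. (M *v e) \<bullet> vector_derivative (\<lambda>t. E t *v V) (at s)" ..
      \<comment> \<open>The scalar limit, initial value over eigenvalue, is identified by applying
        \<open>eig\<close> at \<open>matrix_inv H *v V\<close>, using that \<open>E 0 *v V\<close>
        is \<open>V\<close>.\<close>
      have "((M *v e) \<bullet> (E 0 *v V)) / l = (M *v e) \<bullet> (matrix_inv H *v V)"
        using eig[of "matrix_inv H *v V"] sol l(1)
        by (simp add: is_solution_def matrix_vector_mul_assoc H_inv field_simps)
      then have "?lim e" using solution_asymptotics by simp
      then have "((\<lambda>t. c * (((M *v e) \<bullet> (E t *v V)) / frac_kernel \<nu> t) + ((M *v v) \<bullet> (E t *v V)) / frac_kernel \<nu> t)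
          \<longlongrightarrow> c * ((M *v e) \<bullet> (matrix_inv H *v V)) + (M *v v) \<bullet> (matrix_inv H *v V)) at_top"
        using step by (intro tendsto_intros)
      then show ?case
        by (simp add: matrix_vector_right_distrib matrix_vector_mult_scaleR inner_add_left add_divide_distrib)
    qed simp
  qed
  have entry: "axis i 1 \<bullet> (A *v V) = A $ i $ j" for A :: "real^'n^'n"
    by (simp add: V_def matrix_vector_mult_basis column_def inner_axis')
  \<comment> \<open>As \<open>M\<close> is onto, the pairing can be made to read off row
    \<open>i\<close>; \<open>V\<close> already selects column \<open>j\<close>.\<close>
  have "M *v (matrix_inv M *v axis i 1) = axis i 1"
    by (simp add: matrix_vector_mul_assoc M_inv)
  then show ?thesis
    using limit[of "matrix_inv M *v axis i 1"] by (simp add: entry)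
qed

theorem theorem3p2:
  fixes \<nu> :: "real measure"
    and \<Omega> :: "(real^2) set" and \<T> :: "(real^2) set set"
    and P :: "'n::finite \<Rightarrow> real^2" and \<phi> :: "'n \<Rightarrow> real^2 \<Rightarrow> real"
    and ip :: "(real^2 \<Rightarrow> real) \<Rightarrow> (real^2 \<Rightarrow> real) \<Rightarrow> real"
    and H :: "real^'n^'n" and E :: "real \<Rightarrow> real^'n^'n"
  assumes "multi_term \<nu> \<or> distributed_order \<nu>"
    and "polygonal_domain \<Omega>" and "triangulates \<T> \<Omega>"
    and "bij_betw P UNIV (interior_nodes \<T> \<Omega>)" and "nodal_basis \<T> \<Omega> P \<phi>"
    and "inner_product_on (fe_space \<T> \<Omega>) ip"
    and "H = matrix_inv (mass_matrix ip \<phi>) ** stiffness_matrix \<Omega> \<phi>"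
    and "is_solution_matrix \<nu> H E"
    and "elementwise_pos (matrix_inv H)"
  shows "\<exists>t0>0. \<forall>t>t0. elementwise_pos (E t)"
proof -
  have \<nu>: "order_measure \<nu>"
    using assms(1) order_measure_multi_term order_measure_distributed_order by blast
  then interpret order_measure \<nu> .
  have nodes: "range P \<subseteq> \<Omega>"
    using assms(4) by (auto simp: bij_betw_def interior_nodes_def)
  have limit: "((\<lambda>t. E t $ i $ j / frac_kernel \<nu> t) \<longlongrightarrow> matrix_inv H $ i $ j) at_top" for i j
    by (rule solution_matrix_asymptotics[OF \<nu> transpose_mass_matrix[OF assms(6,5)]
        transpose_stiffness_matrix mass_matrix_posdef[OF assms(6,5)]
        stiffness_matrix_posdef[OF assms(2,3,5) nodes] assms(7,8)])
  have "\<forall>\<^sub>F t in at_top. 0 < E t $ i $ j" for i j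
  proof -
    have "\<forall>\<^sub>F t in at_top. 0 < E t $ i $ j / frac_kernel \<nu> t"
      using assms(9) by (intro order_tendstoD(1)[OF limit]) (simp add: elementwise_pos_def)
    then show ?thesis
      using eventually_gt_at_top[of 0]
      by eventually_elim (use frac_kernel_pos in \<open>auto simp: zero_less_divide_iff dest: less_asym\<close>)
  qed
  \<comment> \<open>There are finitely many entries, so a common threshold exists.\<close>
  then have "\<forall>\<^sub>F t in at_top. elementwise_pos (E t)"
    unfolding elementwise_pos_def by (intro eventually_all_finite) auto
  then obtain N where "\<forall>t\<ge>N. elementwise_pos (E t)"
    unfolding eventually_at_top_linorder by blast
  then show ?thesis by (intro exI[of _ "max N 1"]) auto
qed

end
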